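(* Let $0<\gamma<1$, $T>0$, $b,d>0$ and $a,c<0$ (the "generic" B/FD case). Let $\mu\ge 1$, and suppose that the 1-periodic initial-value problem for the B/FD system with initial data $(\zeta_0,u_0)$ has a unique solution $(\zeta,u)$ on $[0,T]$ with $\zeta,u\in C([0,T];H^{\mu})$. For an integer $N\ge1$ let $(\zeta_N,u_N)$ be the Fourier-Galerkin semidiscrete approximation in $S_N$. Then there exist $N_0$ and a constant $C$ independent of $N$ such that for all $N\ge N_0$ the semidiscrete solution $(\zeta_N,u_N)$ is defined on $[0,T]$ and $$\max_{0\le t\le T}\left(\|\zeta_N(t)-\zeta(t)\|+\|u_N(t)-u(t)\|\right)\le C N^{-\mu}.$$
   Context: B/FD (Boussinesq/Full dispersion) system, with constants $a=\frac{1-\alpha_1-3\beta}{3}$, $b=\frac{\alpha_1}{3}$, $c=\beta\alpha_2$, $d=\beta(1-\alpha_2)$, where $\alpha_1\ge0$, $\alpha_2\le1$, $\beta\ge0$: $$(1-b\partial_x^2)\zeta_t+\tfrac1\gamma((1-\zeta)u)_x-\tfrac1{\gamma^2}(|D|\coth|D|)u_x+\tfrac1\gamma\left(a-\tfrac1{\gamma^2}\coth^2|D|\right)u_{xxx}=0,$$ $$(1-d\partial_x^2)u_t+(1-\gamma)\zeta_x-\tfrac1\gamma uu_x+c(1-\gamma)\zeta_{xxx}=0,$$ with $D=\frac1i\partial_x$ and real-valued unknowns $\zeta(x,t),u(x,t)$ that are 1-periodic in $x$, with $\zeta(\cdot,0)=\zeta_0$, $u(\cdot,0)=u_0$. For a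 1-periodic $f$ let $\widehat f(k)=\int_0^1 f(x)e^{-2\pi i kx}dx$, $k\in\mathbb Z$. $\|\cdot\|$ is the norm of $L^2(0,1)$, and $H^s$ is the Sobolev space of 1-periodic functions with norm $\|f\|_s=\left(\sum_{k\in\mathbb Z}(1+k^2)^s|\widehat f(k)|^2\right)^{1/2}$. Put $\kappa=2\pi k$ and $$g(\kappa)=\tfrac1\gamma-\tfrac1{\gamma^2}|\kappa|\coth|\kappa|-\tfrac{a\kappa^2}{\gamma}+\tfrac{\kappa^2}{\gamma^3}\coth^2|\kappa|\quad(\kappa\ne0),$$ extended by continuity to $\kappa=0$ (so $g(0)=\frac1\gamma-\frac1{\gamma^2}+\frac1{\gamma^3}$). In Fourier form the initial-value problem reads, for all $k\in\mathbb Z$, $t\in[0,T]$, $$\widehat\zeta_t+\frac{i\kappa}{1+b\kappa^2}g(\kappa)\widehat u=\frac{i}{\gamma}\frac{\kappa}{1+b\kappa^2}\widehat{\zeta u},\qquad \widehat u_t+i\kappa\frac{(1-\gamma)(1-c\kappa^2)}{1+d\kappa^2}\widehat\zeta=\frac{i}{2\gamma}\frac{\kappa}{1+d\kappa^2}\widehat{u^2},$$ with $\widehat\zeta(k,0)=\widehat{\zeta_0}(k)$, $\widehat u(k,0)=\widehat{u_0}(k)$. $S_N=\mathrm{span}\{e^{2\pi ikx}:k\in\mathbb Z,\ -N\le k\le N\}$. The Fourier-Galerkin semidiscrete approximation is the solution $(\zeta_N(t),u_N(t))\in S_N\times S_N$ of the ODE system obtained by imposing the same Fourier equations for $(\zeta_N,u_N)$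 in place of $(\zeta,u)$ only for $-N\le k\le N$, with $\widehat{\zeta_N}(k,0)=\widehat{\zeta_0}(k)$, $\widehat{u_N}(k,0)=\widehat{u_0}(k)$ for $-N\le k\le N$. *)

theory Defs
  imports "HOL-Analysis.Analysis"
begin

definition periodic1 :: "(real \<Rightarrow> complex) \<Rightarrow> bool" where
  "periodic1 f \<longleftrightarrow> (\<forall>x. f (x + 1) = f x)"

definition square_integrable01 :: "(real \<Rightarrow> complex) \<Rightarrow> bool" where
  "square_integrable01 f \<longleftrightarrow> f \<in> borel_measurable (lebesgue_on {0..1}) \<and>
     integrable (lebesgue_on {0..1}) (\<lambda>x. (cmod (f x))\<^sup>2)"

definition L2_norm01 :: "(real \<Rightarrow> complex) \<Rightarrow> real" where
  "L2_norm01 f = sqrt (integral\<^sup>L (lebesgue_on {0..1}) (\<lambda>x. (cmod (f x))\<^sup>2))"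

definition fourier_coeff :: "(real \<Rightarrow> complex) \<Rightarrow> int \<Rightarrow> complex" where
  "fourier_coeff f k =
     integral\<^sup>L (lebesgue_on {0..1}) (\<lambda>x. f x * exp (- (2 * of_real pi * \<i> * of_int k * of_real x)))"

text \<open>Elements of the Sobolev spaces are represented by everywhere defined functions; two functions
  that agree almost everywhere represent the same element.\<close>

definition Hs :: "real \<Rightarrow> (real \<Rightarrow> complex) set" where
  "Hs s = {f. periodic1 f \<and> square_integrable01 f \<and>
     (\<lambda>k::int. (1 + (real_of_int k)\<^sup>2) powr s * (cmod (fourier_coeff f k))\<^sup>2) summable_on UNIV}"

definition Hs_norm :: "real \<Rightarrow> (real \<Rightarrow> complex) \<Rightarrow> real" where
  "Hs_norm s f =
     sqrt (\<Sum>\<^sub>\<infinity>k::int. (1 + (real_of_int k)\<^sup>2) powr s * (cmod (fourier_coeff f k))\<^sup>2)"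

definition continuous_Hs :: "real \<Rightarrow> real \<Rightarrow> (real \<Rightarrow> real \<Rightarrow> complex) \<Rightarrow> bool" where
  "continuous_Hs T s v \<longleftrightarrow> (\<forall>t\<in>{0..T}. v t \<in> Hs s \<and>
     ((\<lambda>r. Hs_norm s (\<lambda>x. v r x - v t x)) \<longlongrightarrow> 0) (at t within {0..T}))"

definition coth :: "real \<Rightarrow> real" where
  "coth x = cosh x / sinh x"

definition bfd_g :: "real \<Rightarrow> real \<Rightarrow> real \<Rightarrow> real" where
  "bfd_g \<gamma> a \<kappa> =
     (if \<kappa> = 0 then 1 / \<gamma> - 1 / \<gamma>\<^sup>2 + 1 / \<gamma>^3
      else 1 / \<gamma> - 1 / \<gamma>\<^sup>2 * \<bar>\<kappa>\<bar> * coth \<bar>\<kappa>\<bar> - a * \<kappa>\<^sup>2 / \<gamma>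
           + \<kappa>\<^sup>2 / \<gamma>^3 * (coth \<bar>\<kappa>\<bar>)\<^sup>2)"

lemma isCont_bfd_g_0: "isCont (bfd_g \<gamma> a) 0"
proof -
  have "((\<lambda>x::real. sinh x / x) \<longlongrightarrow> 1) (at 0)"
    using has_field_derivative_sinh[OF DERIV_ident, of "0::real" UNIV] by (simp add: has_field_derivative_iff)
  then have "((\<lambda>x::real. cosh x / (sinh x / x)) \<longlongrightarrow> cosh 0 / 1) (at 0)"
    by (intro tendsto_divide tendsto_cosh tendsto_ident_at) auto
  then have lim: "((\<lambda>x::real. cosh x * x / sinh x) \<longlongrightarrow> 1) (at 0)"
    by simp
  have "((\<lambda>x. 1 / \<gamma> - 1 / \<gamma>\<^sup>2 * (cosh x * x / sinh x) - a * x\<^sup>2 / \<gamma>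
           + 1 / \<gamma>^3 * (cosh x * x / sinh x)\<^sup>2)
         \<longlongrightarrow> 1 / \<gamma> - 1 / \<gamma>\<^sup>2 * 1 - a * 0\<^sup>2 * inverse \<gamma> + 1 / \<gamma>^3 * 1\<^sup>2) (at 0)"
    unfolding divide_inverse[of "a * _"] by (intro tendsto_intros lim)
  moreover have "bfd_g \<gamma> a x = 1 / \<gamma> - 1 / \<gamma>\<^sup>2 * (cosh x * x / sinh x) - a * x\<^sup>2 / \<gamma>
           + 1 / \<gamma>^3 * (cosh x * x / sinh x)\<^sup>2" if "x \<noteq> 0" for x
    using that by (cases "x > 0") (simp_all add: bfd_g_def coth_def power_mult_distrib power_divide mult_ac)
  ultimately have "(bfd_g \<gamma> a \<longlongrightarrow> bfd_g \<gamma> a 0) (at 0)"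
    by (subst tendsto_cong[OF eventually_mono[OF eventually_neq_at_within[of 0]]])
       (auto simp: bfd_g_def)
  then show ?thesis by (simp add: isCont_def)
qed

text \<open>The Fourier form of the system, with time derivatives on \<^term>\<open>{0..T}\<close> (one-sided at the
  endpoints) and the equations required for the frequencies in \<^term>\<open>K\<close> only: all integers for the
  continuous problem, \<^term>\<open>{-int N..int N}\<close> for the Galerkin approximation.\<close>

definition bfd_fourier_system ::
  "int set \<Rightarrow> real \<Rightarrow> real \<Rightarrow> real \<Rightarrow> real \<Rightarrow> real \<Rightarrow> real \<Rightarrow>
   (real \<Rightarrow> real \<Rightarrow> complex) \<Rightarrow> (real \<Rightarrow> real \<Rightarrow> complex) \<Rightarrow> bool" where
  "bfd_fourier_system K T \<gamma> a b c d \<zeta> u \<longleftrightarrow>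
     (\<forall>k\<in>K. \<forall>t\<in>{0..T}. let \<kappa> = 2 * pi * real_of_int k in
        \<exists>\<zeta>' u'.
          ((\<lambda>r. fourier_coeff (\<zeta> r) k) has_vector_derivative \<zeta>') (at t within {0..T}) \<and>
          ((\<lambda>r. fourier_coeff (u r) k) has_vector_derivative u') (at t within {0..T}) \<and>
          \<zeta>' + \<i> * of_real (\<kappa> / (1 + b * \<kappa>\<^sup>2) * bfd_g \<gamma> a \<kappa>) * fourier_coeff (u t) k
            = \<i> * of_real (1 / \<gamma> * (\<kappa> / (1 + b * \<kappa>\<^sup>2))) * fourier_coeff (\<lambda>x. \<zeta> t x * u t x) k \<and>
          u' + \<i> * of_real (\<kappa> * ((1 - \<gamma>) * (1 - c * \<kappa>\<^sup>2) / (1 + d * \<kappa>\<^sup>2))) * fourier_coeff (\<zeta> t) k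
            = \<i> * of_real (1 / (2 * \<gamma>) * (\<kappa> / (1 + d * \<kappa>\<^sup>2))) * fourier_coeff (\<lambda>x. (u t x)\<^sup>2) k)"

definition bfd_solution ::
  "real \<Rightarrow> real \<Rightarrow> real \<Rightarrow> real \<Rightarrow> real \<Rightarrow> real \<Rightarrow> real \<Rightarrow> (real \<Rightarrow> real) \<Rightarrow> (real \<Rightarrow> real) \<Rightarrow>
   (real \<Rightarrow> real \<Rightarrow> real) \<Rightarrow> (real \<Rightarrow> real \<Rightarrow> real) \<Rightarrow> bool" where
  "bfd_solution \<mu> T \<gamma> a b c d \<zeta>0 u0 \<zeta> u \<longleftrightarrow>
     continuous_Hs T \<mu> (\<lambda>t x. of_real (\<zeta> t x)) \<and>
     continuous_Hs T \<mu> (\<lambda>t x. of_real (u t x)) \<and>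
     bfd_fourier_system UNIV T \<gamma> a b c d (\<lambda>t x. of_real (\<zeta> t x)) (\<lambda>t x. of_real (u t x)) \<and>
     (\<forall>k. fourier_coeff (\<lambda>x. of_real (\<zeta> 0 x)) k = fourier_coeff (\<lambda>x. of_real (\<zeta>0 x)) k) \<and>
     (\<forall>k. fourier_coeff (\<lambda>x. of_real (u 0 x)) k = fourier_coeff (\<lambda>x. of_real (u0 x)) k)"

text \<open>Uniqueness is up to almost everywhere equality in space, as appropriate for elements of
  the Sobolev spaces.\<close>

definition bfd_unique_solution ::
  "real \<Rightarrow> real \<Rightarrow> real \<Rightarrow> real \<Rightarrow> real \<Rightarrow> real \<Rightarrow> real \<Rightarrow> (real \<Rightarrow> real) \<Rightarrow> (real \<Rightarrow> real) \<Rightarrow>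
   (real \<Rightarrow> real \<Rightarrow> real) \<Rightarrow> (real \<Rightarrow> real \<Rightarrow> real) \<Rightarrow> bool" where
  "bfd_unique_solution \<mu> T \<gamma> a b c d \<zeta>0 u0 \<zeta> u \<longleftrightarrow>
     bfd_solution \<mu> T \<gamma> a b c d \<zeta>0 u0 \<zeta> u \<and>
     (\<forall>\<eta> v. bfd_solution \<mu> T \<gamma> a b c d \<zeta>0 u0 \<eta> v \<longrightarrow>
        (\<forall>t\<in>{0..T}. (AE x in lebesgue. \<eta> t x = \<zeta> t x) \<and> (AE x in lebesgue. v t x = u t x)))"

text \<open>The complex span of the exponentials of frequency at most \<^term>\<open>N\<close>.\<close>

definition trig_space :: "nat \<Rightarrow> (real \<Rightarrow> complex) set" where
  "trig_space N = {f. \<exists>p::int \<Rightarrow> complex.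
     \<forall>x. f x = (\<Sum>k=-int N..int N. p k * exp (2 * of_real pi * \<i> * of_int k * of_real x))}"

definition bfd_galerkin ::
  "nat \<Rightarrow> real \<Rightarrow> real \<Rightarrow> real \<Rightarrow> real \<Rightarrow> real \<Rightarrow> real \<Rightarrow> (real \<Rightarrow> real) \<Rightarrow> (real \<Rightarrow> real) \<Rightarrow>
   (real \<Rightarrow> real \<Rightarrow> complex) \<Rightarrow> (real \<Rightarrow> real \<Rightarrow> complex) \<Rightarrow> bool" where
  "bfd_galerkin N T \<gamma> a b c d \<zeta>0 u0 \<zeta>N uN \<longleftrightarrow>
     (\<forall>t\<in>{0..T}. \<zeta>N t \<in> trig_space N \<and> uN t \<in> trig_space N) \<and>
     bfd_fourier_system {-int N..int N} T \<gamma> a b c d \<zeta>N uN \<and>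
     (\<forall>k\<in>{-int N..int N}.
        fourier_coeff (\<zeta>N 0) k = fourier_coeff (\<lambda>x. of_real (\<zeta>0 x)) k \<and>
        fourier_coeff (uN 0) k = fourier_coeff (\<lambda>x. of_real (u0 x)) k)"

end

theory Submission
  imports Defs
begin

text \<open>In Fourier variables the linear part of the system is antisymmetric for the energy
  \<open>\<Sum>\<^sub>k w\<^sub>1 |\<zeta>\<^sub>k|\<^sup>2 + w\<^sub>2 |u\<^sub>k|\<^sup>2\<close> with \<open>w\<^sub>1 = (1 - \<gamma>) (1 - c \<kappa>\<^sup>2) / (1 + d \<kappa>\<^sup>2)\<close> and
  \<open>w\<^sub>2 = g(\<kappa>) / (1 + b \<kappa>\<^sup>2)\<close>, and both weights lie between positive constants. The coefficients of a
  product are bounded by the product of the \<open>L\<^sup>2\<close> norms and \<open>\<Sum>\<^sub>k (\<kappa> / (1 + b \<kappa>\<^sup>2))\<^sup>2\<close> converges, so the nonlinear terms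
  are bounded bilinear maps on \<open>L\<^sup>2\<close>. Hence the energy \<open>E\<close> of the difference between the Galerkin solution and the truncated
  Fourier series satisfies \<open>E' \<le> K (E + N\<^sup>-\<^sup>2\<^sup>\<mu>)\<close> as long as \<open>E < 1\<close>, and for large \<open>N\<close> Gronwall's inequality
  keeps \<open>E\<close> below 1. Existence on \<open>[0, T]\<close> follows by cutting off the coefficients in the nonlinear terms at a
  height that, by the same estimate, is never reached.\<close>

section \<open>Square integrable functions on the unit interval\<close>

text \<open>The convergence estimate uses no norm of the approximation beyond L2: the division by
  \<open>1 + b * \<kappa>\<^sup>2\<close> and \<open>1 + d * \<kappa>\<^sup>2\<close> pays for the
  derivative in the nonlinear terms, so no inverse inequality appears, and the rate is exactly that
  of truncating the exact solution. Two obstacles shape the rest. Sobolev regularity is expressed by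
  coefficients while the error is an integral norm; linking the two needs completeness of the
  exponentials, which is derived from the Stone-Weierstrass theorem. And the quadratic terms are not
  globally Lipschitz, so existence up to \<open>T\<close> is not known before the error estimate,
  which must therefore cover the cut-off system as well. For this reason it assumes of the cut-off
  \<open>R\<close> only that distances to points of the ball of radius \<open>B\<close>, where all
  exact coefficients lie, do not grow; \<open>id\<close> and the projection onto a larger ball both
  qualify. The estimate holds for every solution of the coefficient system, so the conclusion covers
  all Galerkin solutions and not just the constructed one.\<close>

lemma square_integrable01_mult_integrable:
  assumes "square_integrable01 f" "square_integrable01 g"
  shows "integrable (lebesgue_on {0..1}) (\<lambda>x. f x * g x)"
proof (rule Bochner_Integration.integrable_bound)
  show "integrable (lebesgue_on {0..1}) (\<lambda>x. (cmod (f x))\<^sup>2 + (cmod (g x))\<^sup>2)"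
    using assms by (simp add: square_integrable01_def)
  show "(\<lambda>x. f x * g x) \<in> borel_measurable (lebesgue_on {0..1})"
    using assms by (auto simp: square_integrable01_def)
  show "AE x in lebesgue_on {0..1}. norm (f x * g x) \<le> norm ((cmod (f x))\<^sup>2 + (cmod (g x))\<^sup>2)"
  proof (rule AE_I2)
    fix x
    have "cmod (f x) * cmod (g x) \<le> (cmod (f x))\<^sup>2 + (cmod (g x))\<^sup>2"
      using sum_squares_bound[of "cmod (f x)" "cmod (g x)"]
            mult_nonneg_nonneg[OF norm_ge_zero norm_ge_zero, of "f x" "g x"] by linarith
    then show "norm (f x * g x) \<le> norm ((cmod (f x))\<^sup>2 + (cmod (g x))\<^sup>2)"
      by (simp add: norm_mult)
  qed
qed

lemma square_integrable01_add:
  assumes "square_integrable01 f" "square_integrable01 g"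
  shows "square_integrable01 (\<lambda>x. f x + g x)"
  unfolding square_integrable01_def
proof
  show "(\<lambda>x. f x + g x) \<in> borel_measurable (lebesgue_on {0..1})"
    using assms by (auto simp: square_integrable01_def)
  show "integrable (lebesgue_on {0..1}) (\<lambda>x. (cmod (f x + g x))\<^sup>2)"
  proof (rule Bochner_Integration.integrable_bound)
    show "integrable (lebesgue_on {0..1}) (\<lambda>x. 2 * (cmod (f x))\<^sup>2 + 2 * (cmod (g x))\<^sup>2)"
      using assms by (simp add: square_integrable01_def)
    show "(\<lambda>x. (cmod (f x + g x))\<^sup>2) \<in> borel_measurable (lebesgue_on {0..1})"
      using assms by (auto simp: square_integrable01_def)
    show "AE x in lebesgue_on {0..1}.
        norm ((cmod (f x + g x))\<^sup>2) \<le> norm (2 * (cmod (f x))\<^sup>2 + 2 * (cmod (g x))\<^sup>2)"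
    proof (rule AE_I2)
      fix x
      have "(cmod (f x + g x))\<^sup>2 \<le> (cmod (f x) + cmod (g x))\<^sup>2"
        by (intro power_mono norm_triangle_ineq) auto
      also have "\<dots> \<le> 2 * (cmod (f x))\<^sup>2 + 2 * (cmod (g x))\<^sup>2"
        using sum_squares_bound[of "cmod (f x)" "cmod (g x)"] by (simp add: power2_sum)
      finally show "norm ((cmod (f x + g x))\<^sup>2) \<le> norm (2 * (cmod (f x))\<^sup>2 + 2 * (cmod (g x))\<^sup>2)"
        by simp
    qed
  qed
qed

lemma square_integrable01_cmult:
  assumes "square_integrable01 f"
  shows "square_integrable01 (\<lambda>x. c * f x)"
  using assms by (auto simp: square_integrable01_def norm_mult power_mult_distrib)

lemma square_integrable01_diff:
  assumes "square_integrable01 f" "square_integrable01 g"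
  shows "square_integrable01 (\<lambda>x. f x - g x)"
  using square_integrable01_add[OF assms(1) square_integrable01_cmult[OF assms(2), of "-1"]] by simp

lemma square_integrable01_bounded:
  assumes "f \<in> borel_measurable (lebesgue_on {0..1})" "\<And>x. x \<in> {0..1} \<Longrightarrow> cmod (f x) \<le> B"
  shows "square_integrable01 f"
  unfolding square_integrable01_def
proof
  show "integrable (lebesgue_on {0..1}) (\<lambda>x. (cmod (f x))\<^sup>2)"
  proof (rule Bochner_Integration.integrable_bound)
    show "integrable (lebesgue_on {0..1::real}) (\<lambda>x. B\<^sup>2)"
      by simp
    show "AE x in lebesgue_on {0..1}. norm ((cmod (f x))\<^sup>2) \<le> norm (B\<^sup>2)"
      by (rule AE_I2) (use assms(2) in \<open>auto intro!: power_mono\<close>)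
  qed (use assms(1) in auto)
qed (rule assms(1))

lemma continuous_imp_square_integrable01:
  assumes "continuous_on {0..1} f"
  shows "square_integrable01 f"
proof -
  have "compact (f ` {0..1})"
    using assms by (intro compact_continuous_image) auto
  then obtain B where "\<And>x. x \<in> {0..1} \<Longrightarrow> cmod (f x) \<le> B"
    using compact_imp_bounded[of "f ` {0..1}"] unfolding bounded_iff by blast
  then show ?thesis
    by (intro square_integrable01_bounded[of f B] continuous_imp_measurable_on_sets_lebesgue assms) auto
qed

lemma square_integrable01_cnj:
  "square_integrable01 f \<Longrightarrow> square_integrable01 (\<lambda>x. cnj (f x))"
  by (auto simp: square_integrable01_def intro: borel_measurable_continuous_onI
      intro!: measurable_compose[of f _ borel cnj] continuous_intros)

lemma L2_norm01_nonneg [simp]: "L2_norm01 f \<ge> 0"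
  by (simp add: L2_norm01_def)

lemma L2_norm01_sq: "(L2_norm01 f)\<^sup>2 = integral\<^sup>L (lebesgue_on {0..1}) (\<lambda>x. (cmod (f x))\<^sup>2)"
  by (simp add: L2_norm01_def)

lemma L2_norm01_minus_commute: "L2_norm01 (\<lambda>x. f x - g x) = L2_norm01 (\<lambda>x. g x - f x)"
  by (simp add: L2_norm01_def norm_minus_commute)

text \<open>The pointwise bound \<open>2 |f g| \<le> r |f|\<^sup>2 + |g|\<^sup>2 / r\<close>, integrated and optimised over \<open>r\<close>.\<close>

lemma L2_Cauchy_Schwarz:
  assumes "square_integrable01 f" "square_integrable01 g"
  shows "integral\<^sup>L (lebesgue_on {0..1}) (\<lambda>x. cmod (f x * g x)) \<le> L2_norm01 f * L2_norm01 g"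
proof -
  let ?I = "integral\<^sup>L (lebesgue_on {0..1}) (\<lambda>x. cmod (f x * g x))"
  have young: "2 * ?I \<le> r * (L2_norm01 f)\<^sup>2 + (L2_norm01 g)\<^sup>2 / r" if "r > 0" for r
  proof -
    have "2 * ?I = integral\<^sup>L (lebesgue_on {0..1}) (\<lambda>x. 2 * cmod (f x * g x))"
      by simp
    also have "\<dots> \<le> integral\<^sup>L (lebesgue_on {0..1}) (\<lambda>x. r * (cmod (f x))\<^sup>2 + (cmod (g x))\<^sup>2 / r)"
    proof (rule integral_mono)
      show "integrable (lebesgue_on {0..1}) (\<lambda>x. 2 * cmod (f x * g x))"
        using square_integrable01_mult_integrable[OF assms] by (intro integrable_mult_right integrable_norm)
      show "integrable (lebesgue_on {0..1}) (\<lambda>x. r * (cmod (f x))\<^sup>2 + (cmod (g x))\<^sup>2 / r)"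
        using assms by (simp add: square_integrable01_def)
      fix x
      have "0 \<le> (r * cmod (f x) - cmod (g x))\<^sup>2 / r"
        using that by simp
      also have "\<dots> = r * (cmod (f x))\<^sup>2 + (cmod (g x))\<^sup>2 / r - 2 * cmod (f x * g x)"
        using that by (simp add: power2_diff norm_mult field_simps power2_eq_square)
      finally show "2 * cmod (f x * g x) \<le> r * (cmod (f x))\<^sup>2 + (cmod (g x))\<^sup>2 / r"
        by simp
    qed
    also have "\<dots> = r * (L2_norm01 f)\<^sup>2 + (L2_norm01 g)\<^sup>2 / r"
      unfolding L2_norm01_sq using assms by (simp add: square_integrable01_def)
    finally show ?thesis .
  qed
  \<comment> \<open>The optimal \<open>r\<close> is the quotient of the two norms, either of which
    may vanish. Adding \<open>e\<close> keeps both positive, and \<open>e\<close> tends to 0 at the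
    end.\<close>
  have bound: "?I \<le> (L2_norm01 f + e) * (L2_norm01 g + e)" if "e > 0" for e
  proof -
    define A B where "A = L2_norm01 f + e" and "B = L2_norm01 g + e"
    have A: "A > 0" "L2_norm01 f \<le> A" and B: "B > 0" "L2_norm01 g \<le> B"
      using that by (simp_all add: A_def B_def add_nonneg_pos)
    have "2 * ?I \<le> B / A * (L2_norm01 f)\<^sup>2 + (L2_norm01 g)\<^sup>2 / (B / A)"
      using A B by (intro young) simp
    also have "\<dots> \<le> B / A * A\<^sup>2 + B\<^sup>2 / (B / A)"
      using A B by (intro add_mono mult_left_mono divide_right_mono power_mono) auto
    also have "\<dots> = 2 * (A * B)"
      using A B by (simp add: power2_eq_square)
    finally show ?thesis by (simp add: A_def B_def)
  qed
  have "((\<lambda>e. (L2_norm01 f + e) * (L2_norm01 g + e)) \<longlongrightarrow> (L2_norm01 f + 0) * (L2_norm01 g + 0)) (at_right 0)"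
    by (intro tendsto_intros)
  moreover have "\<forall>\<^sub>F e in at_right 0. ?I \<le> (L2_norm01 f + e) * (L2_norm01 g + e)"
    using eventually_at_right_less[of "0::real"] by eventually_elim (rule bound)
  ultimately show ?thesis
    using tendsto_lowerbound[of _ _ "at_right (0::real)" ?I] by force
qed

lemma L2_norm01_triangle:
  assumes "square_integrable01 f" "square_integrable01 g"
  shows "L2_norm01 (\<lambda>x. f x + g x) \<le> L2_norm01 f + L2_norm01 g"
proof (rule power2_le_imp_le)
  have "(L2_norm01 (\<lambda>x. f x + g x))\<^sup>2
      \<le> integral\<^sup>L (lebesgue_on {0..1}) (\<lambda>x. (cmod (f x))\<^sup>2 + (cmod (g x))\<^sup>2 + 2 * cmod (f x * g x))"
    unfolding L2_norm01_sq
  proof (rule integral_mono)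
    show "integrable (lebesgue_on {0..1}) (\<lambda>x. (cmod (f x + g x))\<^sup>2)"
      using square_integrable01_add[OF assms] by (simp add: square_integrable01_def)
    show "integrable (lebesgue_on {0..1}) (\<lambda>x. (cmod (f x))\<^sup>2 + (cmod (g x))\<^sup>2 + 2 * cmod (f x * g x))"
      using assms square_integrable01_mult_integrable[OF assms]
      by (intro Bochner_Integration.integrable_add integrable_mult_right integrable_norm) (auto simp: square_integrable01_def)
    fix x
    have "(cmod (f x + g x))\<^sup>2 \<le> (cmod (f x) + cmod (g x))\<^sup>2"
      by (intro power_mono norm_triangle_ineq) auto
    then show "(cmod (f x + g x))\<^sup>2 \<le> (cmod (f x))\<^sup>2 + (cmod (g x))\<^sup>2 + 2 * cmod (f x * g x)"
      by (simp add: power2_sum norm_mult)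
  qed
  also have "\<dots> = (L2_norm01 f)\<^sup>2 + (L2_norm01 g)\<^sup>2 + 2 * integral\<^sup>L (lebesgue_on {0..1}) (\<lambda>x. cmod (f x * g x))"
    unfolding L2_norm01_sq
    using assms square_integrable01_mult_integrable[OF assms, THEN integrable_norm]
    by (subst Bochner_Integration.integral_add) (auto simp: square_integrable01_def)
  also have "\<dots> \<le> (L2_norm01 f + L2_norm01 g)\<^sup>2"
    using L2_Cauchy_Schwarz[OF assms] by (simp add: power2_sum)
  finally show "(L2_norm01 (\<lambda>x. f x + g x))\<^sup>2 \<le> (L2_norm01 f + L2_norm01 g)\<^sup>2" .
qed simp

section \<open>Fourier coefficients and trigonometric polynomials\<close>

definition fexp :: "int \<Rightarrow> real \<Rightarrow> complex" where
  "fexp k x = exp (2 * of_real pi * \<i> * of_int k * of_real x)"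

definition trig_poly :: "nat \<Rightarrow> (int \<Rightarrow> complex) \<Rightarrow> real \<Rightarrow> complex" where
  "trig_poly N p x = (\<Sum>k=-int N..int N. p k * fexp k x)"

lemma trig_space_eq_range: "trig_space N = range (trig_poly N)"
  by (auto simp: trig_space_def trig_poly_def fexp_def fun_eq_iff image_iff)

lemma norm_fexp [simp]: "cmod (fexp k x) = 1"
  by (simp add: fexp_def)

lemma cnj_fexp: "cnj (fexp k x) = fexp (- k) x"
  by (simp add: fexp_def exp_cnj)

lemma fexp_add: "fexp (j + k) x = fexp j x * fexp k x"
  by (simp add: fexp_def exp_add [symmetric] algebra_simps)

lemma fexp_0 [simp]: "fexp 0 x = 1"
  by (simp add: fexp_def)

lemma continuous_fexp [continuous_intros]: "continuous_on S (fexp k)"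
  unfolding fexp_def by (intro continuous_intros)

lemma continuous_trig_poly [continuous_intros]: "continuous_on S (trig_poly N p)"
  unfolding trig_poly_def by (intro continuous_intros)

lemma square_integrable01_fexp [simp]: "square_integrable01 (fexp k)"
  by (intro continuous_imp_square_integrable01 continuous_intros)

lemma square_integrable01_trig_poly [simp]: "square_integrable01 (trig_poly N p)"
  by (intro continuous_imp_square_integrable01 continuous_intros)

lemma L2_norm01_fexp [simp]: "L2_norm01 (fexp k) = 1"
  by (simp add: L2_norm01_def measure_restrict_space)

lemma fourier_coeff_eq: "fourier_coeff f k = integral\<^sup>L (lebesgue_on {0..1}) (\<lambda>x. f x * fexp (- k) x)"
  by (simp add: fourier_coeff_def fexp_def)

lemma integral_fexp: "integral\<^sup>L (lebesgue_on {0..1}) (fexp k) = (if k = 0 then 1 else 0)"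
proof (cases "k = 0")
  case True
  then have "fexp k = (\<lambda>x. 1)" by (simp add: fun_eq_iff)
  then show ?thesis using True by (simp add: measure_restrict_space)
next
  case False
  define w where "w = 2 * of_real pi * \<i> * of_int k"
  have w: "w \<noteq> 0" using False by (simp add: w_def)
  have "((\<lambda>x. exp (w * of_real x) / w) has_vector_derivative fexp k x) (at x within {0..1})" for x
    unfolding has_real_derivative_iff_has_vector_derivative fexp_def w_def[symmetric]
    using w by (auto intro!: derivative_eq_intros has_vector_derivative_real_field
        simp: field_simps)
  then have "(fexp k has_integral exp (w * of_real 1) / w - exp (w * of_real 0) / w) {0..1}"
    by (intro fundamental_theorem_of_calculus) auto
  moreover have "exp w = 1"
    using exp_integer_2pi[of "of_int k"] by (simp add: w_def mult_ac)
  ultimately have "integral {0..1} (fexp k) = 0"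
    by (simp add: integral_unique)
  moreover have "integral\<^sup>L (lebesgue_on {0..1}) (fexp k) = integral {0..1} (fexp k)"
    by (intro lebesgue_integral_eq_integral)
       (use square_integrable01_mult_integrable[of "fexp k" "fexp 0"] in auto)
  ultimately show ?thesis using False by simp
qed

lemma fourier_coeff_integrable:
  assumes "square_integrable01 f"
  shows "integrable (lebesgue_on {0..1}) (\<lambda>x. f x * fexp k x)"
  using assms by (intro square_integrable01_mult_integrable) auto

lemma fourier_coeff_diff:
  assumes "square_integrable01 f" "square_integrable01 g"
  shows "fourier_coeff (\<lambda>x. f x - g x) k = fourier_coeff f k - fourier_coeff g k"
  using assms by (simp add: fourier_coeff_eq left_diff_distrib fourier_coeff_integrable)

lemma fourier_coeff_trig_poly:
  assumes "k \<in> {-int N..int N}"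
  shows "fourier_coeff (trig_poly N p) k = p k"
proof -
  have "fourier_coeff (trig_poly N p) k
      = integral\<^sup>L (lebesgue_on {0..1}) (\<lambda>x. \<Sum>j=-int N..int N. p j * fexp (j - k) x)"
    unfolding fourier_coeff_eq trig_poly_def diff_conv_add_uminus fexp_add
    by (simp add: sum_distrib_left mult_ac)
  also have "\<dots> = (\<Sum>j=-int N..int N. p j * integral\<^sup>L (lebesgue_on {0..1}) (fexp (j - k)))"
    using fourier_coeff_integrable[of "fexp 0"]
    by (subst Bochner_Integration.integral_sum) auto
  also have "\<dots> = (\<Sum>j=-int N..int N. if j = k then p j else 0)"
    by (intro sum.cong) (auto simp: integral_fexp)
  also have "\<dots> = p k" using assms by (simp add: sum.delta)
  finally show ?thesis .
qed

text \<open>The exponential has modulus one, so Cauchy-Schwarz bounds all coefficients at once,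
  uniformly in \<open>k\<close>. This replaces an L2 bound of the product, which would need more
  than square integrable factors.\<close>

lemma norm_fourier_coeff_mult_le:
  assumes "square_integrable01 f" "square_integrable01 g"
  shows "cmod (fourier_coeff (\<lambda>x. f x * g x) k) \<le> L2_norm01 f * L2_norm01 g"
proof -
  have "cmod (fourier_coeff (\<lambda>x. f x * g x) k)
      \<le> integral\<^sup>L (lebesgue_on {0..1}) (\<lambda>x. cmod (f x * g x * fexp (- k) x))"
    unfolding fourier_coeff_eq by (rule integral_norm_bound)
  also have "\<dots> = integral\<^sup>L (lebesgue_on {0..1}) (\<lambda>x. cmod (f x * g x))"
    by (simp add: norm_mult)
  also have "\<dots> \<le> L2_norm01 f * L2_norm01 g"
    using assms by (rule L2_Cauchy_Schwarz)
  finally show ?thesis .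
qed

lemma norm_fourier_coeff_le:
  assumes "square_integrable01 f"
  shows "cmod (fourier_coeff f k) \<le> L2_norm01 f"
  using norm_fourier_coeff_mult_le[OF assms square_integrable01_fexp[of 0]] by simp

text \<open>The product need not be square integrable, so \<open>fourier_coeff_diff\<close> does not apply to it.\<close>

lemma fourier_coeff_mult_diff:
  assumes "square_integrable01 f" "square_integrable01 g" "square_integrable01 f'" "square_integrable01 g'"
  shows "cmod (fourier_coeff (\<lambda>x. f x * g x) k - fourier_coeff (\<lambda>x. f' x * g' x) k)
    \<le> L2_norm01 (\<lambda>x. f x - f' x) * L2_norm01 g + L2_norm01 f' * L2_norm01 (\<lambda>x. g x - g' x)"
proof -
  have int: "integrable (lebesgue_on {0..1}) (\<lambda>x. f x * g x * fexp (- k) x)"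
    if "square_integrable01 f" "square_integrable01 g" for f g
  proof -
    have "square_integrable01 (\<lambda>x. fexp (- k) x * g x)"
      using that(2) continuous_imp_measurable_on_sets_lebesgue[OF continuous_fexp, of "{0..1}" "-k"]
      by (auto simp: square_integrable01_def norm_mult)
    from square_integrable01_mult_integrable[OF that(1) this] show ?thesis
      by (simp add: mult_ac)
  qed
  have d1: "square_integrable01 (\<lambda>x. f x - f' x)" and d2: "square_integrable01 (\<lambda>x. g x - g' x)"
    using assms by (simp_all add: square_integrable01_diff)
  have "fourier_coeff (\<lambda>x. f x * g x) k - fourier_coeff (\<lambda>x. f' x * g' x) k
      = integral\<^sup>L (lebesgue_on {0..1}) (\<lambda>x. f x * g x * fexp (- k) x - f' x * g' x * fexp (- k) x)"
    unfolding fourier_coeff_eq using int[OF assms(1,2)] int[OF assms(3,4)] by simp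
  also have "\<dots> = integral\<^sup>L (lebesgue_on {0..1})
      (\<lambda>x. (f x - f' x) * g x * fexp (- k) x + f' x * (g x - g' x) * fexp (- k) x)"
    by (simp add: algebra_simps)
  also have "\<dots> = fourier_coeff (\<lambda>x. (f x - f' x) * g x) k + fourier_coeff (\<lambda>x. f' x * (g x - g' x)) k"
    unfolding fourier_coeff_eq using int[OF d1 assms(2)] int[OF assms(3) d2] by simp
  also have "cmod \<dots> \<le> L2_norm01 (\<lambda>x. f x - f' x) * L2_norm01 g + L2_norm01 f' * L2_norm01 (\<lambda>x. g x - g' x)"
    by (intro norm_triangle_mono norm_fourier_coeff_mult_le d1 d2 assms)
  finally show ?thesis .
qed

text \<open>The square is expanded and then completed in each coefficient. With \<open>p\<close> the
  Fourier coefficients of \<open>f\<close> the last sum vanishes, which is the best approximation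
  property; with \<open>f\<close> zero the identity becomes Parseval's for trigonometric
  polynomials.\<close>

lemma L2_norm01_diff_trig_poly_sq:
  assumes f: "square_integrable01 f"
  shows "(L2_norm01 (\<lambda>x. f x - trig_poly N p x))\<^sup>2
    = (L2_norm01 f)\<^sup>2 - (\<Sum>k=-int N..int N. (cmod (fourier_coeff f k))\<^sup>2)
      + (\<Sum>k=-int N..int N. (cmod (p k - fourier_coeff f k))\<^sup>2)"
proof -
  let ?M = "lebesgue_on {0..1::real}"
  have pair: "integral\<^sup>L ?M (\<lambda>x. g x * cnj (trig_poly N p x))
      = (\<Sum>k=-int N..int N. cnj (p k) * fourier_coeff g k)" if g: "square_integrable01 g" for g
  proof -
    have "integral\<^sup>L ?M (\<lambda>x. g x * cnj (trig_poly N p x))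
        = integral\<^sup>L ?M (\<lambda>x. \<Sum>k=-int N..int N. cnj (p k) * (g x * fexp (- k) x))"
      by (simp add: trig_poly_def sum_distrib_left cnj_fexp mult_ac)
    also have "\<dots> = (\<Sum>k=-int N..int N. cnj (p k) * fourier_coeff g k)"
      using fourier_coeff_integrable[OF g]
      by (subst Bochner_Integration.integral_sum) (auto simp: fourier_coeff_eq)
    finally show ?thesis .
  qed
  have sq: "complex_of_real ((L2_norm01 g)\<^sup>2) = integral\<^sup>L ?M (\<lambda>x. g x * cnj (g x))" for g
    unfolding L2_norm01_sq integral_complex_of_real[symmetric] by (simp add: complex_norm_square[symmetric] flip: of_real_power)
  let ?t = "trig_poly N p"
  have int: "integrable ?M (\<lambda>x. g x * cnj (h x))"
    if "square_integrable01 g" "square_integrable01 h" for g h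
    using that by (intro square_integrable01_mult_integrable square_integrable01_cnj)
  have swap: "integral\<^sup>L ?M (\<lambda>x. ?t x * cnj (f x)) = cnj (integral\<^sup>L ?M (\<lambda>x. f x * cnj (?t x)))"
    using Bochner_Integration.integral_cnj[of ?M "\<lambda>x. f x * cnj (?t x)"] by (simp add: mult.commute del: Bochner_Integration.integral_cnj)
  have "complex_of_real ((L2_norm01 (\<lambda>x. f x - ?t x))\<^sup>2)
      = integral\<^sup>L ?M (\<lambda>x. f x * cnj (f x) - f x * cnj (?t x) - ?t x * cnj (f x) + ?t x * cnj (?t x))"
    unfolding sq by (simp add: algebra_simps)
  also have "\<dots> = integral\<^sup>L ?M (\<lambda>x. f x * cnj (f x)) - integral\<^sup>L ?M (\<lambda>x. f x * cnj (?t x))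
      - cnj (integral\<^sup>L ?M (\<lambda>x. f x * cnj (?t x))) + integral\<^sup>L ?M (\<lambda>x. ?t x * cnj (?t x))"
    using int[OF f f] int[OF f] int[OF _ f] int[of ?t ?t] by (simp add: swap[symmetric])
  also have "\<dots> = of_real ((L2_norm01 f)\<^sup>2) + (\<Sum>k=-int N..int N.
      - (cnj (p k) * fourier_coeff f k) - p k * cnj (fourier_coeff f k) + cnj (p k) * p k)"
    unfolding pair[OF f] pair[OF square_integrable01_trig_poly] sq[symmetric]
    by (simp add: fourier_coeff_trig_poly sum.distrib sum_subtractf sum_negf)
  also have "(\<Sum>k=-int N..int N.
      - (cnj (p k) * fourier_coeff f k) - p k * cnj (fourier_coeff f k) + cnj (p k) * p k)
    = (\<Sum>k=-int N..int N. of_real ((cmod (p k - fourier_coeff f k))\<^sup>2 - (cmod (fourier_coeff f k))\<^sup>2))"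
    unfolding of_real_diff complex_norm_square by (simp add: algebra_simps)
  also have "of_real ((L2_norm01 f)\<^sup>2) + \<dots> = complex_of_real ((L2_norm01 f)\<^sup>2
      + (\<Sum>k=-int N..int N. (cmod (p k - fourier_coeff f k))\<^sup>2 - (cmod (fourier_coeff f k))\<^sup>2))"
    by simp
  finally have "(L2_norm01 (\<lambda>x. f x - ?t x))\<^sup>2 = (L2_norm01 f)\<^sup>2
      + (\<Sum>k=-int N..int N. (cmod (p k - fourier_coeff f k))\<^sup>2 - (cmod (fourier_coeff f k))\<^sup>2)"
    using of_real_eq_iff by blast
  then show ?thesis by (simp add: sum_subtractf)
qed

lemma L2_norm01_trig_poly: "(L2_norm01 (trig_poly N p))\<^sup>2 = (\<Sum>k=-int N..int N. (cmod (p k))\<^sup>2)"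
proof -
  have "L2_norm01 (\<lambda>x. 0) = 0" "fourier_coeff (\<lambda>x. 0) k = 0" for k
    by (simp_all add: L2_norm01_def fourier_coeff_def)
  moreover have "square_integrable01 (\<lambda>x. 0)"
    by (simp add: square_integrable01_def)
  ultimately show ?thesis
    using L2_norm01_diff_trig_poly_sq[of "\<lambda>x. 0" N p] L2_norm01_minus_commute[of "\<lambda>x. 0" "trig_poly N p"]
    by simp
qed

section \<open>Density of trigonometric polynomials in \<open>L\<^sup>2\<close>\<close>

text \<open>Trigonometric polynomials without a degree, so that closure under products is a plain
  induction. A common degree is recovered afterwards by padding with zero coefficients.\<close>

inductive trig_span :: "(real \<Rightarrow> complex) \<Rightarrow> bool" where
  mono: "trig_span (\<lambda>x. c * fexp k x)"
| add: "trig_span f \<Longrightarrow> trig_span g \<Longrightarrow> trig_span (\<lambda>x. f x + g x)"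

lemma trig_span_mult:
  assumes "trig_span f" "trig_span g"
  shows "trig_span (\<lambda>x. f x * g x)"
  using assms(1)
proof induction
  case (mono c k)
  show ?case
    using assms(2)
  proof induction
    case (mono d j)
    then show ?case
      using trig_span.mono[of "c * d" "k + j"] by (simp add: fexp_add mult_ac)
  next
    case (add f g)
    then show ?case using trig_span.add[OF add.IH] by (simp add: distrib_left)
  qed
next
  case (add f1 f2)
  then show ?case using trig_span.add[OF add.IH] by (simp add: distrib_right)
qed

lemma trig_poly_pad:
  assumes "N \<le> M"
  shows "trig_poly N p x = trig_poly M (\<lambda>k. if k \<in> {-int N..int N} then p k else 0) x"
  unfolding trig_poly_def using assms by (intro sum.mono_neutral_cong_left) auto

lemma trig_span_imp_trig_poly: "trig_span f \<Longrightarrow> \<exists>N p. f = trig_poly N p"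
proof (induction rule: trig_span.induct)
  case (mono c k)
  have "c * fexp k x = trig_poly (nat \<bar>k\<bar>) (\<lambda>j. if j = k then c else 0) x" for x
  proof -
    have "trig_poly (nat \<bar>k\<bar>) (\<lambda>j. if j = k then c else 0) x
        = (\<Sum>j=-int (nat \<bar>k\<bar>)..int (nat \<bar>k\<bar>). if j = k then c * fexp j x else 0)"
      unfolding trig_poly_def by (intro sum.cong) auto
    then show ?thesis by (auto simp: sum.delta)
  qed
  then show ?case by (auto simp: fun_eq_iff)
next
  case (add f g)
  then obtain N p M q where f: "f = trig_poly N p" and g: "g = trig_poly M q" by blast
  define p' q' where "p' k = (if k \<in> {-int N..int N} then p k else 0)"
    and "q' k = (if k \<in> {-int M..int M} then q k else 0)" for k
  have "f x = trig_poly (max N M) p' x" "g x = trig_poly (max N M) q' x" for x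
    unfolding f g p'_def q'_def by (rule trig_poly_pad, simp)+
  then have "(\<lambda>x. f x + g x) = trig_poly (max N M) (\<lambda>k. p' k + q' k)"
    by (simp add: fun_eq_iff trig_poly_def sum.distrib distrib_right)
  then show ?case by blast
qed

text \<open>Polynomial functions on the plane are generated by constants and real-linear
  functionals, and on the unit circle such a functional is a combination of \<open>fexp 1\<close>
  and its conjugate \<open>fexp (- 1)\<close>.\<close>

lemma trig_span_real_polynomial:
  assumes "real_polynomial_function h"
  shows "trig_span (\<lambda>x. complex_of_real (h (fexp 1 x)))"
  using assms
proof induction
  case (linear h)
  \<comment> \<open>Chosen such that twice the real part of \<open>c * z\<close> is
    \<open>Re z * h 1 + Im z * h \<i>\<close>.\<close>
  define c where "c = (of_real (h 1) - \<i> * of_real (h \<i>)) / 2"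
  have "complex_of_real (h z) = c * z + cnj c * cnj z" for z
  proof -
    have "h (Re z *\<^sub>R 1 + Im z *\<^sub>R \<i>) = Re z * h 1 + Im z * h \<i>"
      using bounded_linear.linear[OF linear] by (simp add: linear_add linear_scale del: scaleR_conv_of_real)
    moreover have "Re z *\<^sub>R 1 + Im z *\<^sub>R \<i> = z"
      by (simp add: complex_eq_iff)
    ultimately have "h z = Re z * h 1 + Im z * h \<i>" by simp
    then show ?thesis
      by (simp add: complex_eq_iff c_def field_simps)
  qed
  then show ?case
    using trig_span.add[OF trig_span.mono[of c 1] trig_span.mono[of "cnj c" "-1"]]
    by (simp add: cnj_fexp)
next
  case (const c)
  then show ?case using trig_span.mono[of "of_real c" 0] by simp
next
  case (add f g)
  then show ?case using trig_span.add[OF add.IH] by simp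
next
  case (mult f g)
  then show ?case using trig_span_mult[OF mult.IH] by simp
qed

text \<open>The function is transported to the unit circle by \<open>fexp 1\<close>, where
  Stone-Weierstrass supplies a polynomial in the real and imaginary parts; pulled back, it is a
  trigonometric polynomial.\<close>

lemma periodic_trig_approx:
  assumes cont: "continuous_on {0..1} \<phi>" and per: "\<phi> 0 = (\<phi> 1 :: complex)" and e: "e > 0"
  shows "\<exists>N p. \<forall>x\<in>{0..1}. cmod (\<phi> x - trig_poly N p x) < e"
proof -
  define S where "S = fexp 1 ` {0..1}"
  have S: "compact S"
    unfolding S_def by (intro compact_continuous_image continuous_intros) auto
  \<comment> \<open>On the interval \<open>fexp 1\<close> identifies only the two end points, and
    there \<phi> takes equal values; hence the choice is immaterial.\<close>
  define \<psi> where "\<psi> z = \<phi> (SOME x. x \<in> {0..1} \<and> fexp 1 x = z)" for z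
  have inj: "\<phi> x = \<phi> y" if x: "x \<in> {0..1}" and y: "y \<in> {0..1}" and xy: "fexp 1 x = fexp 1 y" for x y
  proof -
    obtain n :: int where "2 * of_real pi * \<i> * of_real x = 2 * of_real pi * \<i> * of_real y + 2 * of_int n * of_real pi * \<i>"
      using xy unfolding fexp_def exp_eq by auto
    then have "of_real (2 * pi) * \<i> * complex_of_real x = of_real (2 * pi) * \<i> * complex_of_real (y + of_int n)"
      by (simp add: algebra_simps)
    then have "x = y + of_int n"
      by (simp del: of_real_add)
    then have "n = 0 \<or> (n = 1 \<and> x = 1 \<and> y = 0) \<or> (n = -1 \<and> x = 0 \<and> y = 1)"
      using x y by auto
    with \<open>x = y + of_int n\<close> per show ?thesis by auto
  qed
  have \<psi>: "\<psi> (fexp 1 x) = \<phi> x" if "x \<in> {0..1}" for x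
  proof -
    have "(SOME y. y \<in> {0..1} \<and> fexp 1 y = fexp 1 x) \<in> {0..1} \<and>
        fexp 1 (SOME y. y \<in> {0..1} \<and> fexp 1 y = fexp 1 x) = fexp 1 x"
      by (rule someI[of _ x]) (use that in auto)
    then show ?thesis unfolding \<psi>_def using inj that by blast
  qed
  \<comment> \<open>The inverse of \<open>fexp 1\<close> is not continuous on the circle.
    Compactness helps: the preimage of a closed set under \<psi> is the image under
    \<open>fexp 1\<close> of a compact set, hence closed.\<close>
  have "continuous_on S \<psi>"
    unfolding continuous_on_closed_vimage[OF compact_imp_closed[OF S]]
  proof safe
    fix B :: "complex set" assume "closed B"
    have "\<psi> -` B \<inter> S = fexp 1 ` ({0..1} \<inter> \<phi> -` B)"
      using \<psi> by (auto simp: S_def)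
    moreover have "closed (\<phi> -` B \<inter> {0..1})"
      using cont \<open>closed B\<close> by (simp add: continuous_on_closed_vimage)
    then have "compact ({0..1} \<inter> \<phi> -` B)"
      using compact_Int_closed[of "{0..1::real}" "\<phi> -` B \<inter> {0..1}"] by (simp add: Int_ac)
    then have "compact (fexp 1 ` ({0..1} \<inter> \<phi> -` B))"
      by (intro compact_continuous_image continuous_intros)
    ultimately show "closed (\<psi> -` B \<inter> S)"
      by (simp add: compact_imp_closed)
  qed
  from Stone_Weierstrass_polynomial_function[OF S this e]
  obtain g where g: "polynomial_function g" "\<And>z. z \<in> S \<Longrightarrow> cmod (\<psi> z - g z) < e"
    by auto
  have "trig_span (\<lambda>x. g (fexp 1 x))"
  proof -
    have "real_polynomial_function (Re \<circ> g)" "real_polynomial_function (Im \<circ> g)"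
      using g(1) bounded_linear_Re bounded_linear_Im by (auto simp: polynomial_function_def)
    then have "trig_span (\<lambda>x. complex_of_real (Re (g (fexp 1 x))))"
        "trig_span (\<lambda>x. complex_of_real (Im (g (fexp 1 x))))"
      by (auto dest!: trig_span_real_polynomial)
    from trig_span.add[OF this(1) trig_span_mult[OF trig_span.mono[of \<i> 0] this(2)]]
    show ?thesis by (simp add: complex_eq[symmetric])
  qed
  then obtain N p where "(\<lambda>x. g (fexp 1 x)) = trig_poly N p"
    using trig_span_imp_trig_poly by blast
  then have "cmod (\<phi> x - trig_poly N p x) < e" if "x \<in> {0..1}" for x
    using g(2)[of "fexp 1 x"] \<psi>[OF that] that by (auto simp: S_def fun_eq_iff)
  then show ?thesis by blast
qed

section \<open>From uniform to mean-square approximation: continuous, bounded, square integrable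
  functions\<close>

lemma L2_norm01_bounded_le:
  assumes "square_integrable01 f" "\<And>x. x \<in> {0..1} \<Longrightarrow> cmod (f x) \<le> B" "B \<ge> 0"
  shows "L2_norm01 f \<le> B"
proof (rule power2_le_imp_le)
  have "(L2_norm01 f)\<^sup>2 \<le> integral\<^sup>L (lebesgue_on {0..1::real}) (\<lambda>x. B\<^sup>2)"
    unfolding L2_norm01_sq
    using assms by (intro integral_mono) (auto simp: square_integrable01_def intro!: power_mono)
  then show "(L2_norm01 f)\<^sup>2 \<le> B\<^sup>2"
    by (simp add: measure_restrict_space)
qed (rule assms(3))

lemma L2_norm01_tendsto_0:
  assumes f: "f \<in> borel_measurable (lebesgue_on {0..1})"
    and g: "\<And>n. g n \<in> borel_measurable (lebesgue_on {0..1})"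
    and w: "integrable (lebesgue_on {0..1}) w"
    and bound: "\<And>n x. x \<in> {0..1} \<Longrightarrow> (cmod (f x - g n x))\<^sup>2 \<le> w x"
    and lim: "AE x in lebesgue_on {0..1}. (\<lambda>n. g n x) \<longlonglongrightarrow> f x"
  shows "(\<lambda>n. L2_norm01 (\<lambda>x. f x - g n x)) \<longlonglongrightarrow> 0"
proof -
  have "(\<lambda>n. integral\<^sup>L (lebesgue_on {0..1}) (\<lambda>x. (cmod (f x - g n x))\<^sup>2))
      \<longlonglongrightarrow> integral\<^sup>L (lebesgue_on {0..1::real}) (\<lambda>x. 0)"
  proof (rule integral_dominated_convergence[where w = w])
    show "AE x in lebesgue_on {0..1}. (\<lambda>n. (cmod (f x - g n x))\<^sup>2) \<longlonglongrightarrow> 0"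
      using lim
    proof eventually_elim
      case (elim x)
      have "(\<lambda>n. (cmod (f x - g n x))\<^sup>2) \<longlonglongrightarrow> (cmod (f x - f x))\<^sup>2"
        by (intro tendsto_intros elim)
      then show ?case by simp
    qed
    show "AE x in lebesgue_on {0..1}. norm ((cmod (f x - g n x))\<^sup>2) \<le> w x" for n
      using bound by (intro AE_I2) auto
  qed (use f g w in auto)
  then show ?thesis
    unfolding L2_norm01_def using tendsto_real_sqrt[where x = 0] by force
qed

definition trig_approx :: "(real \<Rightarrow> complex) \<Rightarrow> bool" where
  "trig_approx f \<longleftrightarrow> (\<forall>e>0. \<exists>N p. L2_norm01 (\<lambda>x. f x - trig_poly N p x) < e)"

lemma trig_approx_limit:
  assumes f: "square_integrable01 f" and g: "\<And>n. square_integrable01 (g n)"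
    and ap: "\<And>n. trig_approx (g n)" and lim: "(\<lambda>n. L2_norm01 (\<lambda>x. f x - g n x)) \<longlonglongrightarrow> 0"
  shows "trig_approx f"
  unfolding trig_approx_def
proof (intro allI impI)
  fix e :: real assume e: "e > 0"
  have "\<forall>\<^sub>F n in sequentially. L2_norm01 (\<lambda>x. f x - g n x) < e / 2"
    using order_tendstoD(2)[OF lim, of "e / 2"] e by simp
  then obtain n where n: "L2_norm01 (\<lambda>x. f x - g n x) < e / 2"
    using eventually_happens' sequentially_bot by blast
  obtain N p where p: "L2_norm01 (\<lambda>x. g n x - trig_poly N p x) < e / 2"
    using ap[of n] e unfolding trig_approx_def by (meson half_gt_zero)
  have "L2_norm01 (\<lambda>x. (f x - g n x) + (g n x - trig_poly N p x))
      \<le> L2_norm01 (\<lambda>x. f x - g n x) + L2_norm01 (\<lambda>x. g n x - trig_poly N p x)"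
    by (intro L2_norm01_triangle square_integrable01_diff f g square_integrable01_trig_poly)
  with n p show "\<exists>N p. L2_norm01 (\<lambda>x. f x - trig_poly N p x) < e"
    by (intro exI[of _ N] exI[of _ p]) simp
qed

lemma trig_approx_continuous:
  assumes "continuous_on {0..1} f" "f 0 = f 1"
  shows "trig_approx f"
  unfolding trig_approx_def
proof (intro allI impI)
  fix e :: real assume e: "e > 0"
  obtain N p where p: "\<And>x. x \<in> {0..1} \<Longrightarrow> cmod (f x - trig_poly N p x) < e / 2"
    using periodic_trig_approx[OF assms, of "e / 2"] e by (meson half_gt_zero)
  have "L2_norm01 (\<lambda>x. f x - trig_poly N p x) \<le> e / 2"
    using e p assms continuous_imp_square_integrable01[OF assms(1)]
    by (intro L2_norm01_bounded_le square_integrable01_diff) (auto intro: less_imp_le)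
  then show "\<exists>N p. L2_norm01 (\<lambda>x. f x - trig_poly N p x) < e"
    using e by (intro exI[of _ N] exI[of _ p]) simp
qed

text \<open>Measurability gives continuous functions converging almost everywhere. They become
  uniformly bounded by projection onto the ball of radius \<open>B\<close>, which fixes the values
  of \<open>f\<close>, and periodic by a factor vanishing at both end points; then dominated
  convergence applies.\<close>

lemma trig_approx_bounded:
  assumes f: "f \<in> borel_measurable (lebesgue_on {0..1})"
    and B: "\<And>x. cmod (f x) \<le> B"
  shows "trig_approx f"
proof -
  have B0: "B \<ge> 0" using norm_ge_zero B order_trans by blast
  have "f measurable_on {0..1}"
    using f by (simp add: measurable_on_iff_borel_measurable)
  then obtain Z g where Z: "negligible Z" and g: "\<And>n. continuous_on UNIV (g n)"
    and lim: "\<And>x. x \<notin> Z \<Longrightarrow> (\<lambda>n. g n x) \<longlonglongrightarrow> (if x \<in> {0..1} then f x else 0)"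
    unfolding measurable_on_def by blast
  \<comment> \<open>Vanishes at 0 and 1 and equals 1 at each interior point as soon as
    \<open>n\<close> is large enough.\<close>
  define cut where "cut n x = min 1 (real n * (x * (1 - x)))" for n x
  define h where "h n x = of_real (cut n x) * closest_point (cball 0 B) (g n x)" for n x
  have cb: "closed (cball (0::complex) B)" "cball (0::complex) B \<noteq> {}" "convex (cball (0::complex) B)"
    using B0 by auto
  have cont: "continuous_on S (h n)" for n S
    unfolding h_def cut_def
    by (intro continuous_intros continuous_on_compose2[OF continuous_on_closest_point[OF cb(3,1,2), of UNIV]]
        continuous_on_subset[OF g]) auto
  have h01: "h n 0 = h n 1" for n
    by (simp add: h_def cut_def)
  have hB: "cmod (h n x) \<le> B" if "x \<in> {0..1}" for n x
  proof -
    have "\<bar>cut n x\<bar> \<le> 1" using that by (auto simp: cut_def min_def)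
    moreover have "cmod (closest_point (cball 0 B) (g n x)) \<le> B"
      using closest_point_in_set[OF cb(1,2), of "g n x"] by simp
    ultimately show ?thesis
      unfolding h_def norm_mult norm_of_real using B0 mult_mono[of "\<bar>cut n x\<bar>" 1 _ B] by simp
  qed
  show ?thesis
  proof (rule trig_approx_limit)
    show "square_integrable01 f" using f B by (intro square_integrable01_bounded[of f B])
    show "square_integrable01 (h n)" "trig_approx (h n)" for n
      using cont h01 by (auto intro: continuous_imp_square_integrable01 trig_approx_continuous)
    show "(\<lambda>n. L2_norm01 (\<lambda>x. f x - h n x)) \<longlonglongrightarrow> 0"
    proof (rule L2_norm01_tendsto_0[where w = "\<lambda>_. (2 * B)\<^sup>2"])
      show "(cmod (f x - h n x))\<^sup>2 \<le> (2 * B)\<^sup>2" if "x \<in> {0..1}" for n x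
        using norm_triangle_ineq4[of "f x" "h n x"] B[of x] hB[OF that, of n] by (intro power_mono) auto
      have "AE x in lebesgue. x \<notin> Z \<union> {0, 1}"
        using Z by (intro AE_not_in) (auto simp: negligible_iff_null_sets[symmetric] negligible_Un)
      then have "AE x in lebesgue_on {0..1}. x \<notin> Z \<union> {0, 1}"
        by (subst AE_restrict_space_iff) (auto elim: eventually_mono)
      then have "AE x in lebesgue_on {0..1}. x \<in> {0<..<1} - Z"
        by (rule AE_mp) (intro AE_I2, auto simp: space_restrict_space)
      then show "AE x in lebesgue_on {0..1}. (\<lambda>n. h n x) \<longlonglongrightarrow> f x"
      proof eventually_elim
        case (elim x)
        have "(\<lambda>n. closest_point (cball 0 B) (g n x)) \<longlonglongrightarrow> closest_point (cball 0 B) (f x)"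
          using lim[of x] elim continuous_at_closest_point[OF cb(3,1,2), of "f x"]
          by (auto intro: isCont_tendsto_compose)
        moreover have "closest_point (cball 0 B) (f x) = f x"
          using B by (intro closest_point_self) auto
        moreover have "(\<lambda>n. cut n x) \<longlonglongrightarrow> 1"
        proof (rule tendsto_eventually)
          have "x * (1 - x) > 0" using elim by simp
          have "\<forall>\<^sub>F n in sequentially. real n \<ge> 1 / (x * (1 - x))"
            by (rule filterlim_real_sequentially[unfolded filterlim_at_top, rule_format])
          then show "\<forall>\<^sub>F n in sequentially. cut n x = 1"
            by eventually_elim (use \<open>x * (1 - x) > 0\<close> in \<open>simp add: cut_def divide_le_eq\<close>)
        qed
        ultimately have "(\<lambda>n. h n x) \<longlonglongrightarrow> of_real 1 * f x"
          unfolding h_def by (intro tendsto_mult tendsto_of_real) auto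
        then show ?case by simp
      qed
    qed (use f cont in \<open>auto intro: continuous_imp_measurable_on_sets_lebesgue\<close>)
  qed
qed

text \<open>Values of modulus above \<open>n\<close> are replaced by 0, so the error is either 0 or
  \<open>f x\<close> and its square is dominated by that of \<open>f\<close>.\<close>

lemma trig_approx_square_integrable01:
  assumes f: "square_integrable01 f"
  shows "trig_approx f"
proof -
  define h where "h n x = (if cmod (f x) \<le> real n then f x else 0)" for n :: nat and x
  have [measurable]: "f \<in> borel_measurable (lebesgue_on {0..1})"
    using f by (simp add: square_integrable01_def)
  have m: "h n \<in> borel_measurable (lebesgue_on {0..1})" for n
    unfolding h_def by measurable
  show ?thesis
  proof (rule trig_approx_limit)
    show "square_integrable01 (h n)" "trig_approx (h n)" for n
      using m by (auto intro!: square_integrable01_bounded[of _ "real n"] trig_approx_bounded[of _ "real n"] simp: h_def)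
    show "(\<lambda>n. L2_norm01 (\<lambda>x. f x - h n x)) \<longlonglongrightarrow> 0"
    proof (rule L2_norm01_tendsto_0)
      show "integrable (lebesgue_on {0..1}) (\<lambda>x. (cmod (f x))\<^sup>2)"
        using f by (simp add: square_integrable01_def)
      show "(cmod (f x - h n x))\<^sup>2 \<le> (cmod (f x))\<^sup>2" for n x
        by (simp add: h_def)
      show "AE x in lebesgue_on {0..1}. (\<lambda>n. h n x) \<longlonglongrightarrow> f x"
      proof (rule AE_I2, rule tendsto_eventually)
        fix x
        have "\<forall>\<^sub>F n in sequentially. real n \<ge> cmod (f x)"
          by (rule filterlim_real_sequentially[unfolded filterlim_at_top, rule_format])
        then show "\<forall>\<^sub>F n in sequentially. h n x = f x"
          by eventually_elim (simp add: h_def)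
      qed
    qed (use m in auto)
  qed (rule f)
qed

text \<open>Completeness enters here. The truncation at a large degree \<open>L\<close> is at least
  as good as any approximating polynomial of degree at most \<open>L\<close>, hence arbitrarily
  good, and the frequencies between \<open>N\<close> and \<open>L\<close> contribute exactly their
  coefficients.\<close>

lemma fourier_tail:
  assumes f: "square_integrable01 f"
    and B: "\<And>M. (\<Sum>k\<in>{-int M..int M} - {-int N..int N}. (cmod (fourier_coeff f k))\<^sup>2) \<le> B\<^sup>2" and "B \<ge> 0"
  shows "L2_norm01 (\<lambda>x. f x - trig_poly N (fourier_coeff f) x) \<le> B"
proof -
  let ?F = "\<lambda>N. L2_norm01 (\<lambda>x. f x - trig_poly N (fourier_coeff f) x)"
  have "?F N \<le> B + e" if e: "e > 0" for e
  proof -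
    obtain M p where p: "L2_norm01 (\<lambda>x. f x - trig_poly M p x) < e"
      using trig_approx_square_integrable01[OF f] e unfolding trig_approx_def by blast
    define L where "L = max M N"
    define q where "q k = (if k \<in> {-int M..int M} then p k else 0)" for k
    have q: "trig_poly M p x = trig_poly L q x" for x
      unfolding q_def by (rule trig_poly_pad) (simp add: L_def)
    have NL: "{-int N..int N} \<subseteq> {-int L..int L}" by (auto simp: L_def)
    have "(?F L)\<^sup>2 \<le> (L2_norm01 (\<lambda>x. f x - trig_poly L q x))\<^sup>2"
      unfolding L2_norm01_diff_trig_poly_sq[OF f] by (simp add: sum_nonneg)
    also have "\<dots> \<le> e\<^sup>2"
      using p unfolding q by (intro power_mono less_imp_le L2_norm01_nonneg)
    finally have "(?F L)\<^sup>2 \<le> e\<^sup>2" .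
    have "(?F N)\<^sup>2 = (?F L)\<^sup>2 + (\<Sum>k\<in>{-int L..int L} - {-int N..int N}. (cmod (fourier_coeff f k))\<^sup>2)"
      unfolding L2_norm01_diff_trig_poly_sq[OF f] using sum.subset_diff[OF NL, of "\<lambda>k. (cmod (fourier_coeff f k))\<^sup>2"]
      by simp
    also have "\<dots> \<le> e\<^sup>2 + B\<^sup>2"
      using \<open>(?F L)\<^sup>2 \<le> e\<^sup>2\<close> B[of L] by linarith
    also have "\<dots> \<le> (B + e)\<^sup>2"
      using e \<open>B \<ge> 0\<close> by (simp add: power2_sum)
    finally show ?thesis
      by (rule power2_le_imp_le) (use e \<open>B \<ge> 0\<close> in simp)
  qed
  then show ?thesis by (rule field_le_epsilon)
qed

section \<open>Ordinary differential equations\<close>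

text \<open>Banach's fixed point theorem in the norm \<open>sup\<^sub>t e\<^sup>-\<^sup>2\<^sup>L\<^sup>t \<parallel>y t\<parallel>\<close>, in which the Picard operator contracts by
  1/2 on the whole interval.\<close>

lemma picard_lipschitz:
  fixes G :: "'a::banach \<Rightarrow> 'a"
  assumes lip: "\<And>x y. norm (G x - G y) \<le> L * norm (x - y)" and L: "L > 0" and T: "T \<ge> 0"
  shows "\<exists>y. y 0 = x0 \<and> (\<forall>t\<in>{0..T}. (y has_vector_derivative G (y t)) (at t within {0..T}))"
proof -
  \<comment> \<open>The Banach space consists of bounded continuous functions on the whole line, so
    functions on the interval are extended by their end values.\<close>
  define cut where "cut t = max 0 (min T t)" for t
  have cut: "cut t \<in> {0..T}" for t using T by (auto simp: cut_def)
  have cut_id: "cut t = t" if "t \<in> {0..T}" for t using that by (auto simp: cut_def)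
  have "L-lipschitz_on UNIV G"
    using lip L by (auto simp: lipschitz_on_def dist_norm)
  then have contG: "continuous_on UNIV G" by (rule lipschitz_on_continuous_on)
  have contF: "continuous_on S (\<lambda>s. G (exp (2 * L * s) *\<^sub>R apply_bcontfun z s))" for z S
    by (intro continuous_on_compose2[OF contG] continuous_intros) auto
  have intF: "(\<lambda>s. G (exp (2 * L * s) *\<^sub>R apply_bcontfun z s)) integrable_on {0..\<tau>}" for z \<tau>
    by (intro integrable_continuous_interval contF)
  \<comment> \<open>The Picard operator in the variable
    \<open>z t = exp (- (2 * L * t)) *\<^sub>R y t\<close>, in which the weighted norm of
    \<open>y\<close> is the plain supremum norm of \<open>z\<close>.\<close>
  define H where "H z \<tau> = exp (- (2 * L * \<tau>)) *\<^sub>R (x0 + integral {0..\<tau>} (\<lambda>s. G (exp (2 * L * s) *\<^sub>R apply_bcontfun z s)))"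
    for z \<tau>
  have contH: "continuous_on {0..T} (H z)" for z
    unfolding H_def by (intro continuous_intros indefinite_integral_continuous_1 intF)
  have bc: "(\<lambda>t. H z (cut t)) \<in> bcontfun" for z
  proof -
    have "continuous_on UNIV (\<lambda>t. H z (cut t))"
      by (rule continuous_on_compose2[OF contH]) (use cut in \<open>auto simp: cut_def intro!: continuous_intros\<close>)
    moreover have "bounded (range (\<lambda>t. H z (cut t)))"
    proof (rule bounded_subset)
      show "bounded (H z ` {0..T})"
        by (intro compact_imp_bounded compact_continuous_image contH) auto
    qed (use cut in auto)
    ultimately show ?thesis by (simp add: bcontfun_def)
  qed
  define \<Phi> where "\<Phi> z = Bcontfun (\<lambda>t. H z (cut t))" for z
  have \<Phi>: "apply_bcontfun (\<Phi> z) t = H z (cut t)" for z t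
    unfolding \<Phi>_def using bc by (simp add: Bcontfun_inverse)
  have "dist (\<Phi> z) (\<Phi> w) \<le> 1 / 2 * dist z w" for z w
  proof (rule dist_bound)
    fix t
    define \<tau> where "\<tau> = cut t"
    have \<tau>: "\<tau> \<ge> 0" using cut[of t] by (simp add: \<tau>_def)
    define D where "D = dist z w"
    have D: "D \<ge> 0" by (simp add: D_def)
    have zw: "norm (apply_bcontfun z s - apply_bcontfun w s) \<le> D" for s
      unfolding D_def by (metis dist_norm dist_bounded)
    \<comment> \<open>The rate \<open>2 * L\<close> of the weight is twice the Lipschitz constant;
      this leaves the factor 1/2 in the primitive, which becomes the contraction constant.\<close>
    have prim: "((\<lambda>s. L * exp (2 * L * s) * D) has_integral
        exp (2 * L * \<tau>) * D / 2 - exp (2 * L * 0) * D / 2) {0..\<tau>}"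
      using \<tau> L by (intro fundamental_theorem_of_calculus)
        (auto simp: has_real_derivative_iff_has_vector_derivative[symmetric] intro!: derivative_eq_intros)
    have "norm (integral {0..\<tau>} (\<lambda>s. G (exp (2 * L * s) *\<^sub>R apply_bcontfun z s))
          - integral {0..\<tau>} (\<lambda>s. G (exp (2 * L * s) *\<^sub>R apply_bcontfun w s)))
        = norm (integral {0..\<tau>} (\<lambda>s. G (exp (2 * L * s) *\<^sub>R apply_bcontfun z s)
            - G (exp (2 * L * s) *\<^sub>R apply_bcontfun w s)))"
      using intF by (simp add: Henstock_Kurzweil_Integration.integral_diff)
    also have "\<dots> \<le> integral {0..\<tau>} (\<lambda>s. L * exp (2 * L * s) * D)"
    proof (rule integral_norm_bound_integral)
      fix s
      have "norm (G (exp (2 * L * s) *\<^sub>R apply_bcontfun z s) - G (exp (2 * L * s) *\<^sub>R apply_bcontfun w s))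
          \<le> L * (exp (2 * L * s) * norm (apply_bcontfun z s - apply_bcontfun w s))"
        by (rule order_trans[OF lip]) (simp add: scaleR_diff_right[symmetric])
      also have "\<dots> \<le> L * (exp (2 * L * s) * D)"
        using L zw by (intro mult_left_mono) auto
      finally show "norm (G (exp (2 * L * s) *\<^sub>R apply_bcontfun z s) - G (exp (2 * L * s) *\<^sub>R apply_bcontfun w s))
          \<le> L * exp (2 * L * s) * D" by (simp add: mult_ac)
    qed (use intF prim in \<open>auto intro: Henstock_Kurzweil_Integration.integrable_diff\<close>)
    also have "\<dots> \<le> exp (2 * L * \<tau>) * D / 2"
      using integral_unique[OF prim] D by simp
    finally have int_le: "norm (integral {0..\<tau>} (\<lambda>s. G (exp (2 * L * s) *\<^sub>R apply_bcontfun z s))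
          - integral {0..\<tau>} (\<lambda>s. G (exp (2 * L * s) *\<^sub>R apply_bcontfun w s)))
        \<le> exp (2 * L * \<tau>) * D / 2" .
    have "dist (H z \<tau>) (H w \<tau>) = exp (- (2 * L * \<tau>)) *
        norm (integral {0..\<tau>} (\<lambda>s. G (exp (2 * L * s) *\<^sub>R apply_bcontfun z s))
          - integral {0..\<tau>} (\<lambda>s. G (exp (2 * L * s) *\<^sub>R apply_bcontfun w s)))"
      by (simp add: H_def dist_norm scaleR_diff_right[symmetric])
    also have "\<dots> \<le> exp (- (2 * L * \<tau>)) * (exp (2 * L * \<tau>) * D / 2)"
      by (intro mult_left_mono int_le) auto
    also have "\<dots> = 1 / 2 * D"
      by (simp add: exp_minus)
    finally show "dist (apply_bcontfun (\<Phi> z) t) (apply_bcontfun (\<Phi> w) t) \<le> 1 / 2 * dist z w"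
      by (simp add: \<Phi> \<tau>_def D_def)
  qed
  then have "\<exists>!z. \<Phi> z = z"
    by (intro banach_fix_type[of "1 / 2"]) auto
  then obtain z where "\<Phi> z = z" by blast
  then have z: "apply_bcontfun z t = H z t" if "t \<in> {0..T}" for t
    using \<Phi>[of z t] cut_id[OF that] by simp
  define y where "y t = exp (2 * L * t) *\<^sub>R apply_bcontfun z t" for t
  have y: "y t = x0 + integral {0..t} (\<lambda>s. G (y s))" if "t \<in> {0..T}" for t
    using z[OF that] by (simp add: y_def H_def exp_minus)
  have "(y has_vector_derivative G (y t)) (at t within {0..T})" if t: "t \<in> {0..T}" for t
  proof (rule has_vector_derivative_transform[OF t])
    have "((\<lambda>u. integral {0..u} (\<lambda>s. G (y s))) has_vector_derivative G (y t)) (at t within {0..T})"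
      using contF[of "{0..T}" z] by (intro integral_has_vector_derivative t) (simp add: y_def)
    then show "((\<lambda>u. x0 + integral {0..u} (\<lambda>s. G (y s))) has_vector_derivative G (y t)) (at t within {0..T})"
      using has_vector_derivative_add[OF has_vector_derivative_const] by fastforce
  qed (use y in auto)
  moreover have "y 0 = x0" using y[of 0] T by simp
  ultimately show ?thesis by blast
qed

text \<open>Makes \<open>picard_lipschitz\<close> applicable to the function space into which finite
  families are embedded next.\<close>

instance bcontfun :: (metric_space, banach) banach ..

text \<open>The families indexed by \<open>I\<close> are embedded into the Banach space of bounded continuous functions on the
  real line, by means of tent functions at the integers.\<close>

lemma picard_finite_family:
  fixes G :: "(int \<Rightarrow> 'b::banach) \<Rightarrow> int \<Rightarrow> 'b"
  assumes I: "finite I" and T: "T \<ge> 0" and L: "L \<ge> 0"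
    and lip: "\<And>v w k. k \<in> I \<Longrightarrow> norm (G v k - G w k) \<le> L * (\<Sum>j\<in>I. norm (v j - w j))"
  shows "\<exists>y. \<forall>k\<in>I. y 0 k = x0 k \<and>
    (\<forall>t\<in>{0..T}. ((\<lambda>r. y r k) has_vector_derivative G (y t) k) (at t within {0..T}))"
proof -
  define tent where "tent x = max 0 (1 - \<bar>x\<bar>)" for x :: real
  have tent: "0 \<le> tent x" "tent x \<le> 1" for x by (auto simp: tent_def)
  have tent_int: "tent (real_of_int k - real_of_int j) = (if k = j then 1 else 0)" for j k
  proof -
    have "\<bar>real_of_int k - real_of_int j\<bar> \<ge> 1" if "k \<noteq> j"
      using that by linarith
    then show ?thesis by (auto simp: tent_def)
  qed
  define E :: "(int \<Rightarrow> 'b) \<Rightarrow> real \<Rightarrow>\<^sub>C 'b"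
    where "E a = Bcontfun (\<lambda>x. \<Sum>k\<in>I. tent (x - of_int k) *\<^sub>R a k)" for a
  have E: "apply_bcontfun (E a) x = (\<Sum>k\<in>I. tent (x - of_int k) *\<^sub>R a k)" for a x
  proof -
    have "(\<lambda>x. \<Sum>k\<in>I. tent (x - of_int k) *\<^sub>R a k) \<in> bcontfun"
    proof (rule bcontfun_normI)
      show "continuous_on UNIV (\<lambda>x. \<Sum>k\<in>I. tent (x - of_int k) *\<^sub>R a k)"
        unfolding tent_def by (intro continuous_intros)
      show "norm (\<Sum>k\<in>I. tent (x - of_int k) *\<^sub>R a k) \<le> (\<Sum>k\<in>I. norm (a k))" for x
        using tent by (intro sum_norm_le) (auto intro: mult_left_le_one_le)
    qed
    then show ?thesis by (simp add: E_def Bcontfun_inverse)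
  qed
  have E_int: "apply_bcontfun (E a) (of_int k) = a k" if "k \<in> I" for a k
  proof -
    have "apply_bcontfun (E a) (of_int k) = (\<Sum>j\<in>I. if k = j then a j else 0)"
      unfolding E by (intro sum.cong) (auto simp: tent_int)
    then show ?thesis using I that by simp
  qed
  define F where "F v = E (G (\<lambda>j. apply_bcontfun v (of_int j)))" for v :: "real \<Rightarrow>\<^sub>C 'b"
  \<comment> \<open>One factor \<open>card I\<close> comes from summing over the tents, the other
    from summing the differences in the Lipschitz hypothesis. The added 1 keeps \<open>K\<close>
    positive when \<open>L\<close> or \<open>I\<close> is trivial.\<close>
  define K where "K = real (card I) * (L * real (card I)) + 1"
  have K: "K > 0" unfolding K_def using L by (simp add: add_nonneg_pos)
  have lipF: "norm (F v - F w) \<le> K * norm (v - w)" for v w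
  proof (rule norm_bound)
    fix x
    let ?g = "\<lambda>v. G (\<lambda>j. apply_bcontfun v (of_int j))"
    have "norm (apply_bcontfun (F v - F w) x) = norm (\<Sum>k\<in>I. tent (x - of_int k) *\<^sub>R (?g v k - ?g w k))"
      by (simp add: F_def E sum_subtractf[symmetric] scaleR_diff_right)
    also have "\<dots> \<le> (\<Sum>k\<in>I. L * (real (card I) * norm (v - w)))"
    proof (rule sum_norm_le)
      fix k assume k: "k \<in> I"
      have "norm (tent (x - of_int k) *\<^sub>R (?g v k - ?g w k)) \<le> norm (?g v k - ?g w k)"
        using tent by (auto intro: mult_left_le_one_le)
      also have "\<dots> \<le> L * (\<Sum>j\<in>I. norm (apply_bcontfun v (of_int j) - apply_bcontfun w (of_int j)))"
        by (rule lip[OF k])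
      also have "\<dots> \<le> L * (\<Sum>j\<in>I. norm (v - w))"
        using norm_bounded[of "v - w"] L by (intro mult_left_mono sum_mono) auto
      finally show "norm (tent (x - of_int k) *\<^sub>R (?g v k - ?g w k)) \<le> L * (real (card I) * norm (v - w))"
        by simp
    qed
    also have "\<dots> \<le> K * norm (v - w)"
      by (simp add: K_def algebra_simps)
    finally show "norm (apply_bcontfun (F v - F w) x) \<le> K * norm (v - w)" .
  qed
  have "\<exists>y. y 0 = E x0 \<and> (\<forall>t\<in>{0..T}. (y has_vector_derivative F (y t)) (at t within {0..T}))"
    by (rule picard_lipschitz[OF _ K T]) (rule lipF)
  then obtain y where y: "y 0 = E x0" "\<And>t. t \<in> {0..T} \<Longrightarrow> (y has_vector_derivative F (y t)) (at t within {0..T})"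
    by blast
  have bl: "bounded_linear (\<lambda>v :: real \<Rightarrow>\<^sub>C 'b. apply_bcontfun v x)" for x
    by (rule bounded_linear_intro[of _ 1]) (auto intro: norm_bounded)
  show ?thesis
  proof (intro exI[of _ "\<lambda>t k. apply_bcontfun (y t) (of_int k)"] ballI conjI)
    fix k t assume "k \<in> I" "t \<in> {0..T}"
    then show "((\<lambda>r. apply_bcontfun (y r) (of_int k)) has_vector_derivative
        G (\<lambda>k. apply_bcontfun (y t) (of_int k)) k) (at t within {0..T})"
      using bounded_linear.has_vector_derivative[OF bl[of "of_int k"] y(2)[of t]] by (simp add: F_def E_int)
  qed (use y(1) E_int in simp)
qed

text \<open>The differential inequality is available only below height 1. At a first time with
  \<open>E\<close> at least 1, Gronwall on the interval before it would already give a value below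
  1, a contradiction.\<close>

lemma gronwall_bootstrap:
  fixes E E' :: "real \<Rightarrow> real"
  assumes der: "\<And>t. t \<in> {0..T} \<Longrightarrow> (E has_real_derivative E' t) (at t within {0..T})"
    and E0: "E 0 = 0"
    and bound: "\<And>t. t \<in> {0..T} \<Longrightarrow> E t < 1 \<Longrightarrow> E' t \<le> K * (E t + \<delta>)"
    and K: "K \<ge> 0" and \<delta>: "\<delta> \<ge> 0" and small: "\<delta> * exp (K * T) < 1" and t: "t \<in> {0..T}"
  shows "E t \<le> \<delta> * exp (K * T)"
proof -
  have cont: "continuous_on {0..T} E"
    using der by (meson DERIV_continuous continuous_on_eq_continuous_within)
  \<comment> \<open>Only times strictly before \<tau> have to lie below 1, so that this can be
    applied at the first exit time itself. The integrating factor makes \<open>h\<close>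
    nonincreasing.\<close>
  have gron: "E \<tau> \<le> \<delta> * exp (K * T)"
    if \<tau>: "\<tau> \<in> {0..T}" and below: "\<And>s. 0 < s \<Longrightarrow> s < \<tau> \<Longrightarrow> E s < 1" for \<tau>
  proof -
    define h where "h s = (E s + \<delta>) * exp (- (K * s))" for s
    have "h \<tau> \<le> h 0"
    proof (rule DERIV_nonpos_imp_decreasing_open[of 0 \<tau> h])
      show "0 \<le> \<tau>" using \<tau> by simp
      show "continuous_on {0..\<tau>} h"
        unfolding h_def using \<tau> by (intro continuous_intros continuous_on_subset[OF cont]) auto
      fix s assume s: "0 < s" "s < \<tau>"
      then have s': "s \<in> {0..T}" using \<tau> by auto
      have "(E has_real_derivative E' s) (at s)"
        using der[OF s'] s \<tau> by (simp add: at_within_Icc_at)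
      then have "(h has_real_derivative (E' s - K * (E s + \<delta>)) * exp (- (K * s))) (at s)"
        unfolding h_def by (auto intro!: derivative_eq_intros simp: algebra_simps)
      moreover have "(E' s - K * (E s + \<delta>)) * exp (- (K * s)) \<le> 0"
        using bound[OF s' below[OF s]] by (simp add: mult_nonpos_nonneg)
      ultimately show "\<exists>y. (h has_real_derivative y) (at s) \<and> y \<le> 0" by blast
    qed
    then have "E \<tau> + \<delta> \<le> \<delta> * exp (K * \<tau>)"
      by (simp add: h_def E0 exp_minus field_simps)
    also have "\<dots> \<le> \<delta> * exp (K * T)"
      using \<tau> K \<delta> by (intro mult_left_mono) (auto intro: mult_left_mono)
    finally show ?thesis using \<delta> by simp
  qed
  have "E s < 1" if s: "s \<in> {0..T}" for s
  proof (rule ccontr)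
    assume "\<not> E s < 1"
    define S where "S = {0..T} \<inter> E -` {1..}"
    have "s \<in> S" using s \<open>\<not> E s < 1\<close> by (simp add: S_def)
    have "closed S"
      unfolding S_def using cont continuous_on_closed_vimage[of "{0..T}" E] by (subst Int_commute) simp
    moreover have bdd: "bdd_below S" by (auto simp: S_def intro!: bdd_belowI[of _ 0])
    ultimately have m: "Inf S \<in> S"
      using \<open>s \<in> S\<close> by (intro closed_contains_Inf) auto
    have "E (Inf S) \<le> \<delta> * exp (K * T)"
    proof (rule gron)
      show "Inf S \<in> {0..T}" using m by (simp add: S_def)
      show "E r < 1" if "0 < r" "r < Inf S" for r
      proof (rule ccontr)
        assume "\<not> E r < 1"
        then have "r \<in> S" using that m by (auto simp: S_def)
        then show False using cInf_lower[OF _ bdd] that by force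
      qed
    qed
    then show False using small m by (simp add: S_def)
  qed
  then show ?thesis using t by (intro gron) auto
qed

section \<open>The Galerkin system and its energy estimate\<close>

lemma trig_poly_diff: "trig_poly N p x - trig_poly N q x = trig_poly N (\<lambda>k. p k - q k) x"
  by (simp add: trig_poly_def sum_subtractf left_diff_distrib)

lemma L2_norm01_trig_poly_le_sum: "L2_norm01 (trig_poly N p) \<le> (\<Sum>k=-int N..int N. cmod (p k))"
proof (rule power2_le_imp_le)
  have "(\<Sum>k\<in>I. (cmod (p k))\<^sup>2) \<le> (\<Sum>k\<in>I. cmod (p k))\<^sup>2" if "finite I" for I
    using that
  proof induction
    case (insert k I)
    have "0 \<le> cmod (p k) * (\<Sum>k\<in>I. cmod (p k))"
      by (intro mult_nonneg_nonneg sum_nonneg) auto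
    then show ?case using insert by (simp add: power2_sum)
  qed simp
  then show "(L2_norm01 (trig_poly N p))\<^sup>2 \<le> (\<Sum>k=-int N..int N. cmod (p k))\<^sup>2"
    by (simp add: L2_norm01_trig_poly)
qed (simp add: sum_nonneg)

text \<open>The finite convolution of two coefficient families, encoded as an integral so that the
  bounds for coefficients of products apply to it directly.\<close>

definition trig_conv :: "nat \<Rightarrow> (int \<Rightarrow> complex) \<Rightarrow> (int \<Rightarrow> complex) \<Rightarrow> int \<Rightarrow> complex" where
  "trig_conv N p q = fourier_coeff (\<lambda>x. trig_poly N p x * trig_poly N q x)"

text \<open>The Galerkin equations for the coefficients \<open>P\<close>, \<open>Q\<close> with weights \<open>w1\<close>, \<open>w2\<close> in the linear part and
  multipliers \<open>m1\<close>, \<open>m2\<close> in the nonlinear part, where the coefficients in the nonlinear terms are cut off by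
  \<open>R\<close>. The original system is the case \<open>R = id\<close>; a bounded \<open>R\<close> makes the system globally Lipschitz.\<close>

definition galerkin_coeffs ::
  "nat \<Rightarrow> real \<Rightarrow> (int \<Rightarrow> real) \<Rightarrow> (int \<Rightarrow> real) \<Rightarrow> (int \<Rightarrow> real) \<Rightarrow> (int \<Rightarrow> real) \<Rightarrow> (int \<Rightarrow> real) \<Rightarrow>
   (complex \<Rightarrow> complex) \<Rightarrow> (int \<Rightarrow> complex) \<Rightarrow> (int \<Rightarrow> complex) \<Rightarrow>
   (real \<Rightarrow> int \<Rightarrow> complex) \<Rightarrow> (real \<Rightarrow> int \<Rightarrow> complex) \<Rightarrow> bool" where
  "galerkin_coeffs N T \<kappa> w1 w2 m1 m2 R p0 q0 P Q \<longleftrightarrow>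
    (\<forall>k\<in>{-int N..int N}. P 0 k = p0 k \<and> Q 0 k = q0 k \<and> (\<forall>t\<in>{0..T}.
      ((\<lambda>r. P r k) has_vector_derivative
        - \<i> * of_real (\<kappa> k * w2 k) * Q t k
        + \<i> * of_real (m1 k) * trig_conv N (\<lambda>j. R (P t j)) (\<lambda>j. R (Q t j)) k) (at t within {0..T}) \<and>
      ((\<lambda>r. Q r k) has_vector_derivative
        - \<i> * of_real (\<kappa> k * w1 k) * P t k
        + \<i> * of_real (m2 k) * trig_conv N (\<lambda>j. R (Q t j)) (\<lambda>j. R (Q t j)) k) (at t within {0..T})))"

text \<open>The constant grows with \<open>N\<close>, which is harmless: it serves existence for one
  fixed \<open>N\<close> and never enters the error bound.\<close>

lemma trig_conv_lipschitz:
  assumes a: "\<And>k. cmod (a k) \<le> \<rho>" "\<And>k. cmod (a' k) \<le> \<rho>" and b: "\<And>k. cmod (b k) \<le> \<rho>" "\<And>k. cmod (b' k) \<le> \<rho>"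
    and ab: "(\<Sum>k=-int N..int N. cmod (a k - a' k)) \<le> \<Delta>" "(\<Sum>k=-int N..int N. cmod (b k - b' k)) \<le> \<Delta>"
  shows "cmod (trig_conv N a b k - trig_conv N a' b' k) \<le> 2 * (2 * real N + 1) * \<rho> * \<Delta>"
proof -
  have \<Delta>: "\<Delta> \<ge> 0" using ab(1) by (rule order_trans[rotated]) (simp add: sum_nonneg)
  have \<rho>: "(2 * real N + 1) * \<rho> \<ge> 0"
    using order_trans[OF norm_ge_zero a(1)] by simp
  have bd: "L2_norm01 (trig_poly N c) \<le> (2 * real N + 1) * \<rho>" if "\<And>k. cmod (c k) \<le> \<rho>" for c
  proof -
    have "(\<Sum>k=-int N..int N. cmod (c k)) \<le> (\<Sum>k=-int N..int N. \<rho>)"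
      using that by (intro sum_mono) auto
    then show ?thesis using L2_norm01_trig_poly_le_sum[of N c] by (simp add: nat_add_distrib algebra_simps)
  qed
  have df: "L2_norm01 (\<lambda>x. trig_poly N c x - trig_poly N c' x) \<le> \<Delta>"
    if "(\<Sum>k=-int N..int N. cmod (c k - c' k)) \<le> \<Delta>" for c c'
    unfolding trig_poly_diff using L2_norm01_trig_poly_le_sum[of N "\<lambda>k. c k - c' k"] that by linarith
  have "cmod (trig_conv N a b k - trig_conv N a' b' k) \<le>
      L2_norm01 (\<lambda>x. trig_poly N a x - trig_poly N a' x) * L2_norm01 (trig_poly N b)
      + L2_norm01 (trig_poly N a') * L2_norm01 (\<lambda>x. trig_poly N b x - trig_poly N b' x)"
    unfolding trig_conv_def by (intro fourier_coeff_mult_diff square_integrable01_trig_poly)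
  also have "\<dots> \<le> \<Delta> * ((2 * real N + 1) * \<rho>) + ((2 * real N + 1) * \<rho>) * \<Delta>"
    using bd[of b] bd[of a'] df[OF ab(1)] df[OF ab(2)] a b \<Delta> \<rho>
    by (intro add_mono mult_mono) auto
  finally show ?thesis by (simp add: algebra_simps)
qed

lemma galerkin_coeffs_exists:
  assumes R: "\<And>z. cmod (R z) \<le> \<rho>" "\<And>y z. cmod (R y - R z) \<le> cmod (y - z)" and T: "T \<ge> 0"
  shows "\<exists>P Q. galerkin_coeffs N T \<kappa> w1 w2 m1 m2 R p0 q0 P Q"
proof -
  define I where "I = {-int N..int N}"
  have \<rho>: "\<rho> \<ge> 0" using R(1) norm_ge_zero order_trans by blast
  define C where "C v = trig_conv N (\<lambda>j. R (fst (v j))) (\<lambda>j. R (snd (v j)))" for v :: "int \<Rightarrow> complex \<times> complex"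
  define C' where "C' v = trig_conv N (\<lambda>j. R (snd (v j))) (\<lambda>j. R (snd (v j)))" for v :: "int \<Rightarrow> complex \<times> complex"
  define G where "G v k =
      (- \<i> * of_real (\<kappa> k * w2 k) * snd (v k) + \<i> * of_real (m1 k) * C v k,
       - \<i> * of_real (\<kappa> k * w1 k) * fst (v k) + \<i> * of_real (m2 k) * C' v k)" for v k
  define c where "c = 2 * (2 * real N + 1) * \<rho>"
  have c: "c \<ge> 0" using \<rho> by (simp add: c_def)
  \<comment> \<open>A Lipschitz constant for component \<open>k\<close>; the sum over
    \<open>I\<close> then serves all components simultaneously.\<close>
  define l where "l k = \<bar>\<kappa> k * w2 k\<bar> + \<bar>\<kappa> k * w1 k\<bar> + \<bar>m1 k\<bar> * c + \<bar>m2 k\<bar> * c" for k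
  have l: "l k \<ge> 0" for k using c by (simp add: l_def)
  have lipG: "norm (G v k - G w k) \<le> (\<Sum>k\<in>I. l k) * (\<Sum>j\<in>I. norm (v j - w j))" if k: "k \<in> I" for v w k
  proof -
    let ?\<Delta> = "\<Sum>j\<in>I. norm (v j - w j)"
    have fs: "cmod (fst z) \<le> norm z" "cmod (snd z) \<le> norm z" for z :: "complex \<times> complex"
      using norm_fst_le[of "fst z" "snd z"] norm_snd_le[of "snd z" "fst z"] by simp_all
    have kI: "norm (v k - w k) \<le> ?\<Delta>"
      using k by (intro member_le_sum) (auto simp: I_def)
    have s1: "cmod (fst (v k) - fst (w k)) \<le> ?\<Delta>" and s2: "cmod (snd (v k) - snd (w k)) \<le> ?\<Delta>"
      using fs[of "v k - w k"] kI by simp_all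
    have t1: "(\<Sum>j=-int N..int N. cmod (R (fst (v j)) - R (fst (w j)))) \<le> ?\<Delta>"
      unfolding I_def using fs(1)[of "v _ - w _"] by (intro sum_mono order_trans[OF R(2)]) simp
    have t2: "(\<Sum>j=-int N..int N. cmod (R (snd (v j)) - R (snd (w j)))) \<le> ?\<Delta>"
      unfolding I_def using fs(2)[of "v _ - w _"] by (intro sum_mono order_trans[OF R(2)]) simp
    have C: "cmod (C v k - C w k) \<le> c * ?\<Delta>" "cmod (C' v k - C' w k) \<le> c * ?\<Delta>"
      unfolding C_def C'_def c_def by (intro trig_conv_lipschitz R t1 t2)+
    have "norm (G v k - G w k) \<le> norm (fst (G v k - G w k)) + norm (snd (G v k - G w k))"
      using norm_Pair_le[of "fst (G v k - G w k)" "snd (G v k - G w k)"] unfolding prod.collapse .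
    also have "fst (G v k - G w k) = - \<i> * of_real (\<kappa> k * w2 k) * (snd (v k) - snd (w k))
        + \<i> * of_real (m1 k) * (C v k - C w k)"
      by (simp add: G_def algebra_simps)
    also have "snd (G v k - G w k) = - \<i> * of_real (\<kappa> k * w1 k) * (fst (v k) - fst (w k))
        + \<i> * of_real (m2 k) * (C' v k - C' w k)"
      by (simp add: G_def algebra_simps)
    also have "cmod (- \<i> * of_real (\<kappa> k * w2 k) * (snd (v k) - snd (w k)) + \<i> * of_real (m1 k) * (C v k - C w k))
        \<le> \<bar>\<kappa> k * w2 k\<bar> * ?\<Delta> + \<bar>m1 k\<bar> * (c * ?\<Delta>)"
      using s2 C by (intro norm_triangle_mono) (auto simp: norm_mult abs_mult intro!: mult_left_mono)
    also have "cmod (- \<i> * of_real (\<kappa> k * w1 k) * (fst (v k) - fst (w k)) + \<i> * of_real (m2 k) * (C' v k - C' w k))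
        \<le> \<bar>\<kappa> k * w1 k\<bar> * ?\<Delta> + \<bar>m2 k\<bar> * (c * ?\<Delta>)"
      using s1 C by (intro norm_triangle_mono) (auto simp: norm_mult abs_mult intro!: mult_left_mono)
    also have "\<bar>\<kappa> k * w2 k\<bar> * ?\<Delta> + \<bar>m1 k\<bar> * (c * ?\<Delta>) + (\<bar>\<kappa> k * w1 k\<bar> * ?\<Delta> + \<bar>m2 k\<bar> * (c * ?\<Delta>)) = l k * ?\<Delta>"
      by (simp add: l_def algebra_simps)
    also have "\<dots> \<le> (\<Sum>k\<in>I. l k) * ?\<Delta>"
      using k l by (intro mult_right_mono member_le_sum sum_nonneg) (auto simp: I_def)
    finally show ?thesis by simp
  qed
  have "\<exists>y. \<forall>k\<in>I. y 0 k = (p0 k, q0 k) \<and>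
      (\<forall>t\<in>{0..T}. ((\<lambda>r. y r k) has_vector_derivative G (y t) k) (at t within {0..T}))"
    using l by (intro picard_finite_family[OF _ T _ lipG]) (auto simp: I_def sum_nonneg)
  then obtain y where y0: "\<And>k. k \<in> I \<Longrightarrow> y 0 k = (p0 k, q0 k)"
    and y: "\<And>k t. k \<in> I \<Longrightarrow> t \<in> {0..T} \<Longrightarrow> ((\<lambda>r. y r k) has_vector_derivative G (y t) k) (at t within {0..T})"
    by blast
  have "galerkin_coeffs N T \<kappa> w1 w2 m1 m2 R p0 q0 (\<lambda>t k. fst (y t k)) (\<lambda>t k. snd (y t k))"
    unfolding galerkin_coeffs_def I_def[symmetric]
  proof (intro ballI conjI)
    fix k t assume k: "k \<in> I" and t: "t \<in> {0..T}"
    show "((\<lambda>r. fst (y r k)) has_vector_derivative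
        - \<i> * of_real (\<kappa> k * w2 k) * snd (y t k)
        + \<i> * of_real (m1 k) * trig_conv N (\<lambda>j. R (fst (y t j))) (\<lambda>j. R (snd (y t j))) k) (at t within {0..T})"
      using bounded_linear.has_vector_derivative[OF bounded_linear_fst y[OF k t]] by (simp add: G_def C_def)
    show "((\<lambda>r. snd (y r k)) has_vector_derivative
        - \<i> * of_real (\<kappa> k * w1 k) * fst (y t k)
        + \<i> * of_real (m2 k) * trig_conv N (\<lambda>j. R (snd (y t j))) (\<lambda>j. R (snd (y t j))) k) (at t within {0..T})"
      using bounded_linear.has_vector_derivative[OF bounded_linear_snd y[OF k t]] by (simp add: G_def C'_def)
  qed (use y0 in auto)
  then show ?thesis by blast
qed

text \<open>Separates the energy argument from the concrete symbols. What it needs is an L2 bound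
  and a truncation rate for the exact solution, weights between positive constants, and multipliers
  square summable uniformly in \<open>N\<close>. A single \<open>B\<close> serves as norm bound and
  as constant of the rate.\<close>

locale bfd_exact =
  fixes T \<mu> wl wh S B :: real and \<kappa> w1 w2 m1 m2 :: "int \<Rightarrow> real" and Z U :: "real \<Rightarrow> real \<Rightarrow> complex"
  assumes T: "T > 0" and mu: "\<mu> > 0" and wl: "wl > 0"
    and w1: "\<And>k. wl \<le> w1 k" "\<And>k. w1 k \<le> wh" and w2: "\<And>k. wl \<le> w2 k" "\<And>k. w2 k \<le> wh"
    and m1: "\<And>N. (\<Sum>k=-int N..int N. (m1 k)\<^sup>2) \<le> S" and m2: "\<And>N. (\<Sum>k=-int N..int N. (m2 k)\<^sup>2) \<le> S"
    and sqi: "\<And>t. t \<in> {0..T} \<Longrightarrow> square_integrable01 (Z t)" "\<And>t. t \<in> {0..T} \<Longrightarrow> square_integrable01 (U t)"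
    and normB: "\<And>t. t \<in> {0..T} \<Longrightarrow> L2_norm01 (Z t) \<le> B" "\<And>t. t \<in> {0..T} \<Longrightarrow> L2_norm01 (U t) \<le> B"
    and tail: "\<And>t N. t \<in> {0..T} \<Longrightarrow> N \<ge> 1 \<Longrightarrow>
        L2_norm01 (\<lambda>x. Z t x - trig_poly N (fourier_coeff (Z t)) x) \<le> B * real N powr (- \<mu>)"
      "\<And>t N. t \<in> {0..T} \<Longrightarrow> N \<ge> 1 \<Longrightarrow>
        L2_norm01 (\<lambda>x. U t x - trig_poly N (fourier_coeff (U t)) x) \<le> B * real N powr (- \<mu>)"
    and deriv: "\<And>t k. t \<in> {0..T} \<Longrightarrow> ((\<lambda>r. fourier_coeff (Z r) k) has_vector_derivative
        - \<i> * of_real (\<kappa> k * w2 k) * fourier_coeff (U t) k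
        + \<i> * of_real (m1 k) * fourier_coeff (\<lambda>x. Z t x * U t x) k) (at t within {0..T})"
      "\<And>t k. t \<in> {0..T} \<Longrightarrow> ((\<lambda>r. fourier_coeff (U r) k) has_vector_derivative
        - \<i> * of_real (\<kappa> k * w1 k) * fourier_coeff (Z t) k
        + \<i> * of_real (m2 k) * fourier_coeff (\<lambda>x. U t x * U t x) k) (at t within {0..T})"
begin

lemma B_nonneg: "B \<ge> 0"
  using normB(1)[of 0] T L2_norm01_nonneg[of "Z 0"] by (meson atLeastAtMost_iff less_imp_le order_refl order_trans)

lemma wh_pos: "wh > 0"
  using w1[of 0] wl by linarith

lemma S_nonneg: "S \<ge> 0"
  using m1[of 0] by (rule order_trans[rotated]) (simp add: sum_nonneg)

text \<open>The factor \<open>2 * B + \<eta>\<close> is kept apart because it stays below a fixed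
  constant as long as the energy is below 1, which makes the bound linear in the error.\<close>

lemma product_error:
  assumes \<eta>: "L2_norm01 (\<lambda>x. f x - V x) \<le> \<eta>" "L2_norm01 (\<lambda>x. g x - W x) \<le> \<eta>"
    and f: "square_integrable01 f" and g: "square_integrable01 g"
    and V: "square_integrable01 V" "L2_norm01 V \<le> B" and W: "square_integrable01 W" "L2_norm01 W \<le> B"
  shows "cmod (fourier_coeff (\<lambda>x. f x * g x) k - fourier_coeff (\<lambda>x. V x * W x) k) \<le> \<eta> * (2 * B + \<eta>)"
proof -
  have \<eta>0: "\<eta> \<ge> 0" using \<eta>(1) L2_norm01_nonneg order_trans by blast
  have "L2_norm01 (\<lambda>x. (g x - W x) + W x) \<le> L2_norm01 (\<lambda>x. g x - W x) + L2_norm01 W"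
    by (intro L2_norm01_triangle square_integrable01_diff g W)
  then have gB: "L2_norm01 g \<le> \<eta> + B" using \<eta>(2) W(2) by simp
  have "cmod (fourier_coeff (\<lambda>x. f x * g x) k - fourier_coeff (\<lambda>x. V x * W x) k)
      \<le> L2_norm01 (\<lambda>x. f x - V x) * L2_norm01 g + L2_norm01 V * L2_norm01 (\<lambda>x. g x - W x)"
    by (intro fourier_coeff_mult_diff f g V W)
  also have "\<dots> \<le> \<eta> * (\<eta> + B) + B * \<eta>"
    using gB \<eta> V W \<eta>0 B_nonneg by (intro add_mono mult_mono) auto
  finally show ?thesis by (simp add: algebra_simps)
qed

definition err :: "nat \<Rightarrow> (real \<Rightarrow> int \<Rightarrow> complex) \<Rightarrow> (real \<Rightarrow> int \<Rightarrow> complex) \<Rightarrow> real \<Rightarrow> real" where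
  "err N P Q t = (\<Sum>k=-int N..int N. (cmod (P t k - fourier_coeff (Z t) k))\<^sup>2 + (cmod (Q t k - fourier_coeff (U t) k))\<^sup>2)"

lemma err_nonneg: "err N P Q t \<ge> 0"
  by (simp add: err_def sum_nonneg)

text \<open>Here \<open>p\<close> and \<open>q\<close> stand for the possibly cut-off values of
  \<open>P t\<close> and \<open>Q t\<close>. The difference is split at the truncated Fourier
  series: Parseval controls the first part by \<open>err\<close>, the truncation rate the
  second.\<close>

lemma trig_poly_error:
  assumes t: "t \<in> {0..T}" and N: "N \<ge> 1"
    and p: "\<And>k. cmod (p k - fourier_coeff (Z t) k) \<le> cmod (P t k - fourier_coeff (Z t) k)"
    and q: "\<And>k. cmod (q k - fourier_coeff (U t) k) \<le> cmod (Q t k - fourier_coeff (U t) k)"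
  shows "L2_norm01 (\<lambda>x. trig_poly N p x - Z t x) \<le> sqrt (err N P Q t) + B * real N powr (- \<mu>)"
    and "L2_norm01 (\<lambda>x. trig_poly N q x - U t x) \<le> sqrt (err N P Q t) + B * real N powr (- \<mu>)"
proof -
  have gen: "L2_norm01 (\<lambda>x. trig_poly N p x - V x) \<le> sqrt (err N P Q t) + B * real N powr (- \<mu>)"
    if V: "square_integrable01 V" and tl: "L2_norm01 (\<lambda>x. V x - trig_poly N (fourier_coeff V) x) \<le> B * real N powr (- \<mu>)"
      and le: "(\<Sum>k=-int N..int N. (cmod (p k - fourier_coeff V k))\<^sup>2) \<le> err N P Q t" for V p
  proof -
    let ?S = "trig_poly N (fourier_coeff V)"
    have "L2_norm01 (\<lambda>x. trig_poly N p x - ?S x) \<le> sqrt (err N P Q t)"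
      unfolding trig_poly_diff using le by (intro real_le_rsqrt) (simp add: L2_norm01_trig_poly)
    moreover have "L2_norm01 (\<lambda>x. ?S x - V x) \<le> B * real N powr (- \<mu>)"
      using tl L2_norm01_minus_commute[of V ?S] by simp
    moreover have "L2_norm01 (\<lambda>x. (trig_poly N p x - ?S x) + (?S x - V x))
        \<le> L2_norm01 (\<lambda>x. trig_poly N p x - ?S x) + L2_norm01 (\<lambda>x. ?S x - V x)"
      by (intro L2_norm01_triangle square_integrable01_diff V square_integrable01_trig_poly)
    ultimately show ?thesis by simp
  qed
  show "L2_norm01 (\<lambda>x. trig_poly N p x - Z t x) \<le> sqrt (err N P Q t) + B * real N powr (- \<mu>)"
    using p unfolding err_def
    by (intro gen[unfolded err_def] sqi tail t N sum_mono) (auto intro!: add_increasing2 power_mono)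
  show "L2_norm01 (\<lambda>x. trig_poly N q x - U t x) \<le> sqrt (err N P Q t) + B * real N powr (- \<mu>)"
    using q unfolding err_def
    by (intro gen[unfolded err_def] sqi tail t N sum_mono) (auto intro!: add_increasing power_mono)
qed

definition energy :: "nat \<Rightarrow> (real \<Rightarrow> int \<Rightarrow> complex) \<Rightarrow> (real \<Rightarrow> int \<Rightarrow> complex) \<Rightarrow> real \<Rightarrow> real" where
  "energy N P Q t = (\<Sum>k=-int N..int N. w1 k * (cmod (P t k - fourier_coeff (Z t) k))\<^sup>2
     + w2 k * (cmod (Q t k - fourier_coeff (U t) k))\<^sup>2)"

lemma err_le_energy: "wl * err N P Q t \<le> energy N P Q t"
  unfolding err_def energy_def sum_distrib_left distrib_left
  using w1 w2 by (intro sum_mono add_mono mult_right_mono) auto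

text \<open>The weights are chosen such that the linear terms cancel in the derivative of the energy.\<close>

lemma energy_derivative:
  assumes g: "galerkin_coeffs N T \<kappa> w1 w2 m1 m2 R (fourier_coeff (Z 0)) (fourier_coeff (U 0)) P Q"
    and t: "t \<in> {0..T}"
    and D1: "\<And>k. cmod (trig_conv N (\<lambda>j. R (P t j)) (\<lambda>j. R (Q t j)) k - fourier_coeff (\<lambda>x. Z t x * U t x) k) \<le> D"
    and D2: "\<And>k. cmod (trig_conv N (\<lambda>j. R (Q t j)) (\<lambda>j. R (Q t j)) k - fourier_coeff (\<lambda>x. U t x * U t x) k) \<le> D"
  shows "\<exists>E'. (energy N P Q has_real_derivative E') (at t within {0..T}) \<and> E' \<le> wh * (err N P Q t + 2 * S * D\<^sup>2)"
proof -
  have D: "D \<ge> 0" using D1 norm_ge_zero order_trans by blast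
  define \<theta> where "\<theta> r k = P r k - fourier_coeff (Z r) k" for r k
  define \<xi> where "\<xi> r k = Q r k - fourier_coeff (U r) k" for r k
  define n1 where "n1 k = trig_conv N (\<lambda>j. R (P t j)) (\<lambda>j. R (Q t j)) k - fourier_coeff (\<lambda>x. Z t x * U t x) k" for k
  define n2 where "n2 k = trig_conv N (\<lambda>j. R (Q t j)) (\<lambda>j. R (Q t j)) k - fourier_coeff (\<lambda>x. U t x * U t x) k" for k
  define \<theta>' where "\<theta>' k = - \<i> * of_real (\<kappa> k * w2 k) * \<xi> t k + \<i> * of_real (m1 k) * n1 k" for k
  define \<xi>' where "\<xi>' k = - \<i> * of_real (\<kappa> k * w1 k) * \<theta> t k + \<i> * of_real (m2 k) * n2 k" for k
  have d\<theta>: "((\<lambda>r. \<theta> r k) has_vector_derivative \<theta>' k) (at t within {0..T})" if "k \<in> {-int N..int N}" for k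
  proof -
    have "((\<lambda>r. P r k) has_vector_derivative
        - \<i> * of_real (\<kappa> k * w2 k) * Q t k
        + \<i> * of_real (m1 k) * trig_conv N (\<lambda>j. R (P t j)) (\<lambda>j. R (Q t j)) k) (at t within {0..T})"
      using g that t unfolding galerkin_coeffs_def by blast
    from has_vector_derivative_diff[OF this deriv(1)[OF t, of k]] show ?thesis
      by (simp add: \<theta>_def[abs_def] \<theta>'_def \<xi>_def n1_def algebra_simps)
  qed
  have d\<xi>: "((\<lambda>r. \<xi> r k) has_vector_derivative \<xi>' k) (at t within {0..T})" if "k \<in> {-int N..int N}" for k
  proof -
    have "((\<lambda>r. Q r k) has_vector_derivative
        - \<i> * of_real (\<kappa> k * w1 k) * P t k
        + \<i> * of_real (m2 k) * trig_conv N (\<lambda>j. R (Q t j)) (\<lambda>j. R (Q t j)) k) (at t within {0..T})"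
      using g that t unfolding galerkin_coeffs_def by blast
    from has_vector_derivative_diff[OF this deriv(2)[OF t, of k]] show ?thesis
      by (simp add: \<theta>_def \<xi>_def[abs_def] \<xi>'_def n2_def algebra_simps)
  qed
  have sq: "((\<lambda>r. (cmod (f r))\<^sup>2) has_real_derivative 2 * (f t \<bullet> f')) (at t within {0..T})"
    if "(f has_vector_derivative f') (at t within {0..T})" for f f'
  proof -
    have "((\<lambda>r. f r \<bullet> f r) has_vector_derivative f t \<bullet> f' + f' \<bullet> f t) (at t within {0..T})"
      by (rule bounded_bilinear.has_vector_derivative[OF bounded_bilinear_inner that that])
    then show ?thesis
      by (simp add: has_real_derivative_iff_has_vector_derivative power2_norm_eq_inner inner_commute[of f'])
  qed
  define E' where "E' = (\<Sum>k=-int N..int N. w1 k * (2 * (\<theta> t k \<bullet> \<theta>' k)) + w2 k * (2 * (\<xi> t k \<bullet> \<xi>' k)))"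
  have "(energy N P Q has_real_derivative E') (at t within {0..T})"
    unfolding energy_def[abs_def] E'_def \<theta>_def[symmetric] \<xi>_def[symmetric]
    by (intro DERIV_sum DERIV_add DERIV_cmult sq d\<theta> d\<xi>)
  moreover have "E' \<le> wh * (err N P Q t + 2 * S * D\<^sup>2)"
  proof -
    have term_le: "w1 k * (2 * (\<theta> t k \<bullet> \<theta>' k)) + w2 k * (2 * (\<xi> t k \<bullet> \<xi>' k))
        \<le> wh * ((cmod (\<theta> t k))\<^sup>2 + (cmod (\<xi> t k))\<^sup>2 + ((m1 k)\<^sup>2 * D\<^sup>2 + (m2 k)\<^sup>2 * D\<^sup>2))" for k
    proof -
      \<comment> \<open>Young's inequality with the multiplier \<open>m\<close> grouped with
        \<open>D\<close>: after summation over \<open>k\<close> it appears only through its square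
        sum, which is at most \<open>S\<close> for every \<open>N\<close>.\<close>
      have nl: "w * (2 * (z \<bullet> (\<i> * of_real m * n))) \<le> wh * ((cmod z)\<^sup>2 + m\<^sup>2 * D\<^sup>2)"
        if "cmod n \<le> D" "0 \<le> w" "w \<le> wh" for w m z n
      proof -
        have "2 * (z \<bullet> (\<i> * of_real m * n)) \<le> 2 * (cmod z * (\<bar>m\<bar> * cmod n))"
          using norm_cauchy_schwarz[of z "\<i> * of_real m * n"] by (simp add: norm_mult)
        also have "\<dots> \<le> 2 * (cmod z * (\<bar>m\<bar> * D))"
          using that by (intro mult_left_mono) auto
        also have "\<dots> \<le> (cmod z)\<^sup>2 + m\<^sup>2 * D\<^sup>2"
          using sum_squares_bound[of "cmod z" "\<bar>m\<bar> * D"] by (simp add: power_mult_distrib)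
        finally have "w * (2 * (z \<bullet> (\<i> * of_real m * n))) \<le> w * ((cmod z)\<^sup>2 + m\<^sup>2 * D\<^sup>2)"
          using that by (intro mult_left_mono)
        also have "\<dots> \<le> wh * ((cmod z)\<^sup>2 + m\<^sup>2 * D\<^sup>2)"
          using that by (intro mult_right_mono) auto
        finally show ?thesis .
      qed
      \<comment> \<open>Antisymmetric in \<open>x\<close> and \<open>y\<close>. Both linear terms
        carry the same factor \<open>\<kappa> k * w1 k * w2 k\<close>, so they cancel.\<close>
      have rot: "x \<bullet> (- \<i> * of_real r * y) = r * (Re x * Im y - Im x * Re y)" for x y r
        by (simp add: inner_complex_def algebra_simps)
      have cancel: "w1 k * (2 * (\<theta> t k \<bullet> (- \<i> * of_real (\<kappa> k * w2 k) * \<xi> t k)))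
          + w2 k * (2 * (\<xi> t k \<bullet> (- \<i> * of_real (\<kappa> k * w1 k) * \<theta> t k))) = 0"
        unfolding rot by (simp add: algebra_simps)
      have "w1 k * (2 * (\<theta> t k \<bullet> \<theta>' k)) + w2 k * (2 * (\<xi> t k \<bullet> \<xi>' k))
          = w1 k * (2 * (\<theta> t k \<bullet> (\<i> * of_real (m1 k) * n1 k))) + w2 k * (2 * (\<xi> t k \<bullet> (\<i> * of_real (m2 k) * n2 k)))"
        using cancel unfolding \<theta>'_def \<xi>'_def inner_add_right distrib_left by linarith
      also have "\<dots> \<le> wh * ((cmod (\<theta> t k))\<^sup>2 + (m1 k)\<^sup>2 * D\<^sup>2) + wh * ((cmod (\<xi> t k))\<^sup>2 + (m2 k)\<^sup>2 * D\<^sup>2)"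
        using D1 D2 w1[of k] w2[of k] wl unfolding n1_def n2_def by (intro add_mono nl) auto
      finally show ?thesis by (simp add: algebra_simps)
    qed
    have "E' \<le> (\<Sum>k=-int N..int N. wh * ((cmod (\<theta> t k))\<^sup>2 + (cmod (\<xi> t k))\<^sup>2 + ((m1 k)\<^sup>2 * D\<^sup>2 + (m2 k)\<^sup>2 * D\<^sup>2)))"
      unfolding E'_def by (intro sum_mono term_le)
    also have "\<dots> = wh * (err N P Q t + ((\<Sum>k=-int N..int N. (m1 k)\<^sup>2) * D\<^sup>2 + (\<Sum>k=-int N..int N. (m2 k)\<^sup>2) * D\<^sup>2))"
      by (simp add: err_def \<theta>_def \<xi>_def sum.distrib sum_distrib_right flip: sum_distrib_left)
    also have "\<dots> \<le> wh * (err N P Q t + (S * D\<^sup>2 + S * D\<^sup>2))"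
      using wh_pos by (intro mult_left_mono add_left_mono add_mono mult_right_mono m1 m2) auto
    finally show ?thesis by (simp add: algebra_simps)
  qed
  ultimately show ?thesis by blast
qed

text \<open>The constants are fixed before \<open>N\<close> and \<open>R\<close>. Exact coefficients
  have modulus at most \<open>B\<close>, so the condition on \<open>R\<close> says that cutting off
  brings no coefficient farther from its exact value.\<close>

lemma galerkin_error:
  "\<exists>C N0. C \<ge> 0 \<and> N0 \<ge> 1 \<and> (\<forall>N\<ge>N0. \<forall>R P Q.
     (\<forall>y z. cmod y \<le> B \<longrightarrow> cmod (R z - y) \<le> cmod (z - y)) \<longrightarrow>
     galerkin_coeffs N T \<kappa> w1 w2 m1 m2 R (fourier_coeff (Z 0)) (fourier_coeff (U 0)) P Q \<longrightarrow>
     (\<forall>t\<in>{0..T}. err N P Q t \<le> 1 \<and> sqrt (err N P Q t) \<le> C * real N powr (- \<mu>)))"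
proof -
  \<comment> \<open>While the energy is below 1, \<open>sqrt X\<close> is at most
    \<open>sqrt (1 / wl)\<close> and \<epsilon> at most \<open>B\<close>, so \<open>H\<close> bounds
    \<open>2 * B + \<eta>\<close> in \<open>product_error\<close>. \<open>K\<close> adds the
    resulting coefficients of the energy and of \<open>\<epsilon>\<^sup>2\<close> and thus dominates
    each. \<open>A\<close> is the Gronwall bound with the power of \<open>N\<close> split
    off.\<close>
  define H where "H = 2 * B + (sqrt (1 / wl) + B)"
  define K where "K = wh * (1 / wl + 4 * S * H\<^sup>2 / wl) + wh * (4 * S * H\<^sup>2)"
  define A where "A = B\<^sup>2 * exp (K * T)"
  have K: "K \<ge> 0" using wh_pos wl S_nonneg by (simp add: K_def)
  have A: "A \<ge> 0" by (simp add: A_def)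
  have "(\<lambda>N. A * (real N powr (- \<mu>))\<^sup>2) \<longlonglongrightarrow> A * 0\<^sup>2"
    using mu by (intro tendsto_intros tendsto_neg_powr filterlim_real_sequentially) auto
  \<comment> \<open>Below 1 the bootstrap applies; below \<open>wl\<close> also \<open>err\<close>,
    at most the energy divided by \<open>wl\<close>, stays at most 1.\<close>
  then have "\<forall>\<^sub>F N in sequentially. A * (real N powr (- \<mu>))\<^sup>2 < min 1 wl"
    using wl by (intro order_tendstoD(2)) auto
  then obtain N1 where N1: "\<And>N. N \<ge> N1 \<Longrightarrow> A * (real N powr (- \<mu>))\<^sup>2 < min 1 wl"
    unfolding eventually_sequentially by blast
  have main: "err N P Q t \<le> 1 \<and> sqrt (err N P Q t) \<le> sqrt (A / wl) * real N powr (- \<mu>)"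
    if N: "N \<ge> max 1 N1" and R: "\<And>y z. cmod y \<le> B \<Longrightarrow> cmod (R z - y) \<le> cmod (z - y)"
      and g: "galerkin_coeffs N T \<kappa> w1 w2 m1 m2 R (fourier_coeff (Z 0)) (fourier_coeff (U 0)) P Q"
      and t: "t \<in> {0..T}" for N R P Q t
  proof -
    define \<epsilon> where "\<epsilon> = B * real N powr (- \<mu>)"
    have \<epsilon>: "\<epsilon> \<ge> 0" "\<epsilon> \<le> B"
    proof -
      have "real N powr (- \<mu>) \<le> 1"
        using N mu by (simp add: powr_minus ge_one_powr_ge_zero inverse_le_1_iff)
      then show "\<epsilon> \<le> B" "\<epsilon> \<ge> 0" unfolding \<epsilon>_def using B_nonneg by (auto intro: mult_left_le)
    qed
    have "\<exists>E'. (energy N P Q has_real_derivative E') (at s within {0..T}) \<and>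
        (energy N P Q s < 1 \<longrightarrow> E' \<le> K * (energy N P Q s + \<epsilon>\<^sup>2))" if s: "s \<in> {0..T}" for s
    proof -
      define X where "X = err N P Q s"
      define \<eta> where "\<eta> = sqrt X + \<epsilon>"
      have X: "X \<ge> 0" by (simp add: X_def err_nonneg)
      have cB: "cmod (fourier_coeff (Z s) k) \<le> B" "cmod (fourier_coeff (U s) k) \<le> B" for k
        using norm_fourier_coeff_le[OF sqi(1)[OF s]] norm_fourier_coeff_le[OF sqi(2)[OF s]] normB[OF s]
        by (meson order_trans)+
      have e: "L2_norm01 (\<lambda>x. trig_poly N (\<lambda>j. R (P s j)) x - Z s x) \<le> \<eta>"
        "L2_norm01 (\<lambda>x. trig_poly N (\<lambda>j. R (Q s j)) x - U s x) \<le> \<eta>"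
        unfolding \<eta>_def X_def \<epsilon>_def using N cB by (auto intro!: trig_poly_error s R)
      have "\<exists>E'. (energy N P Q has_real_derivative E') (at s within {0..T}) \<and>
          E' \<le> wh * (err N P Q s + 2 * S * (\<eta> * (2 * B + \<eta>))\<^sup>2)"
        unfolding trig_conv_def
        by (intro energy_derivative[OF g s, unfolded trig_conv_def] product_error e sqi normB s
            square_integrable01_trig_poly)
      then obtain E' where E': "(energy N P Q has_real_derivative E') (at s within {0..T})"
        "E' \<le> wh * (X + 2 * S * (\<eta> * (2 * B + \<eta>))\<^sup>2)"
        unfolding X_def by blast
      have "E' \<le> K * (energy N P Q s + \<epsilon>\<^sup>2)" if "energy N P Q s < 1"
      proof -
        define E where "E = energy N P Q s"
        have XE: "X \<le> E / wl"
          using err_le_energy[of N P Q s] wl by (simp add: E_def X_def field_simps)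
        also have "\<dots> \<le> 1 / wl"
          using that wl by (intro divide_right_mono) (auto simp: E_def)
        finally have sX: "sqrt X \<le> sqrt (1 / wl)" by (simp only: real_sqrt_le_iff)
        have \<eta>0: "\<eta> \<ge> 0" using \<epsilon> X by (simp add: \<eta>_def)
        have \<eta>H: "0 \<le> 2 * B + \<eta>" "2 * B + \<eta> \<le> H"
          using \<eta>0 B_nonneg sX \<epsilon>(2) unfolding H_def by (simp, unfold \<eta>_def, linarith)
        have "\<eta>\<^sup>2 \<le> 2 * (X + \<epsilon>\<^sup>2)"
          using sum_squares_bound[of "sqrt X" \<epsilon>] X by (simp add: \<eta>_def power2_sum)
        also have "\<dots> \<le> 2 * (E / wl + \<epsilon>\<^sup>2)"
          using XE by simp
        finally have "(\<eta> * (2 * B + \<eta>))\<^sup>2 \<le> 2 * (E / wl + \<epsilon>\<^sup>2) * H\<^sup>2"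
          unfolding power_mult_distrib using \<eta>H order_trans[OF zero_le_power2] by (intro mult_mono power_mono) auto
        then have "X + 2 * S * (\<eta> * (2 * B + \<eta>))\<^sup>2 \<le> E / wl + 2 * S * (2 * (E / wl + \<epsilon>\<^sup>2) * H\<^sup>2)"
          using S_nonneg by (intro add_mono XE mult_left_mono) auto
        then have "wh * (X + 2 * S * (\<eta> * (2 * B + \<eta>))\<^sup>2)
            \<le> wh * (E / wl + 2 * S * (2 * (E / wl + \<epsilon>\<^sup>2) * H\<^sup>2))"
          using wh_pos by (intro mult_left_mono) auto
        with E'(2) have "E' \<le> wh * (E / wl + 2 * S * (2 * (E / wl + \<epsilon>\<^sup>2) * H\<^sup>2))"
          by (rule order_trans)
        also have "\<dots> = wh * (1 / wl + 4 * S * H\<^sup>2 / wl) * E + wh * (4 * S * H\<^sup>2) * \<epsilon>\<^sup>2"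
          by (simp add: field_simps)
        also have "\<dots> \<le> K * E + K * \<epsilon>\<^sup>2"
        proof (intro add_mono mult_right_mono)
          show "0 \<le> E" using order_trans[OF X XE] wl by (simp add: zero_le_divide_iff)
        qed (use wh_pos wl S_nonneg in \<open>auto simp: K_def\<close>)
        finally show ?thesis by (simp add: E_def algebra_simps)
      qed
      with E' show ?thesis by blast
    qed
    then obtain E' where E': "\<And>s. s \<in> {0..T} \<Longrightarrow> (energy N P Q has_real_derivative E' s) (at s within {0..T})"
      "\<And>s. s \<in> {0..T} \<Longrightarrow> energy N P Q s < 1 \<Longrightarrow> E' s \<le> K * (energy N P Q s + \<epsilon>\<^sup>2)"
      by metis
    have AN: "\<epsilon>\<^sup>2 * exp (K * T) = A * (real N powr (- \<mu>))\<^sup>2"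
      by (simp add: \<epsilon>_def A_def power_mult_distrib)
    have "energy N P Q t \<le> \<epsilon>\<^sup>2 * exp (K * T)"
    proof (rule gronwall_bootstrap[OF E'(1) _ E'(2) K _ _ t])
      show "energy N P Q 0 = 0"
        using g by (auto simp: energy_def galerkin_coeffs_def intro!: sum.neutral)
      show "\<epsilon>\<^sup>2 * exp (K * T) < 1" unfolding AN using N1[of N] N by simp
    qed auto
    then have le: "wl * err N P Q t \<le> A * (real N powr (- \<mu>))\<^sup>2"
      using err_le_energy[of N P Q t] unfolding AN by linarith
    also have "\<dots> \<le> wl * 1" using N1[of N] N by simp
    finally have "err N P Q t \<le> 1" using wl by simp
    moreover have "err N P Q t \<le> A / wl * (real N powr (- \<mu>))\<^sup>2"
      using le wl by (simp add: field_simps)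
    then have "sqrt (err N P Q t) \<le> sqrt (A / wl * (real N powr (- \<mu>))\<^sup>2)"
      by (simp only: real_sqrt_le_iff)
    then have "sqrt (err N P Q t) \<le> sqrt (A / wl) * real N powr (- \<mu>)"
      unfolding real_sqrt_mult by simp
    ultimately show ?thesis by blast
  qed
  show ?thesis
  proof (rule exI[of _ "sqrt (A / wl)"], rule exI[of _ "max 1 N1"], rule conjI[OF _ conjI])
    show "\<forall>N\<ge>max 1 N1. \<forall>R P Q. (\<forall>y z. cmod y \<le> B \<longrightarrow> cmod (R z - y) \<le> cmod (z - y)) \<longrightarrow>
        galerkin_coeffs N T \<kappa> w1 w2 m1 m2 R (fourier_coeff (Z 0)) (fourier_coeff (U 0)) P Q \<longrightarrow>
        (\<forall>t\<in>{0..T}. err N P Q t \<le> 1 \<and> sqrt (err N P Q t) \<le> sqrt (A / wl) * real N powr (- \<mu>))"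
      using main by blast
  qed (use A wl in auto)
qed

text \<open>The error estimate is used twice: with a projection as cut-off, to see that the solution
  of the cut-off system solves the original one, and with \<open>id\<close>, to bound the error of
  an arbitrary solution.\<close>

lemma galerkin_convergence:
  "\<exists>N0\<ge>1. \<exists>C. \<forall>N\<ge>N0.
    (\<exists>P Q. galerkin_coeffs N T \<kappa> w1 w2 m1 m2 id (fourier_coeff (Z 0)) (fourier_coeff (U 0)) P Q) \<and>
    (\<forall>P Q. galerkin_coeffs N T \<kappa> w1 w2 m1 m2 id (fourier_coeff (Z 0)) (fourier_coeff (U 0)) P Q \<longrightarrow>
      (\<forall>t\<in>{0..T}. L2_norm01 (\<lambda>x. trig_poly N (P t) x - Z t x) + L2_norm01 (\<lambda>x. trig_poly N (Q t) x - U t x)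
        \<le> C * real N powr (- \<mu>)))"
proof -
  obtain C N0 where N0: "N0 \<ge> 1" and bound: "\<And>N R P Q t. N \<ge> N0 \<Longrightarrow>
     (\<forall>y z. cmod y \<le> B \<longrightarrow> cmod (R z - y) \<le> cmod (z - y)) \<Longrightarrow>
     galerkin_coeffs N T \<kappa> w1 w2 m1 m2 R (fourier_coeff (Z 0)) (fourier_coeff (U 0)) P Q \<Longrightarrow>
     t \<in> {0..T} \<Longrightarrow> err N P Q t \<le> 1 \<and> sqrt (err N P Q t) \<le> C * real N powr (- \<mu>)"
    using galerkin_error by blast
  have "\<exists>P Q. galerkin_coeffs N T \<kappa> w1 w2 m1 m2 id (fourier_coeff (Z 0)) (fourier_coeff (U 0)) P Q"
    if N: "N \<ge> N0" for N
  proof -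
    \<comment> \<open>The margin 1 in the radius matches \<open>err\<close> at most 1: every
      coefficient of the cut-off solution lies within 1 of an exact one, whose modulus is at most
      \<open>B\<close>.\<close>
    let ?D = "cball (0::complex) (B + 1)"
    define R where "R = closest_point ?D"
    have D: "closed ?D" "convex ?D" "?D \<noteq> {}" using B_nonneg by auto
    have R_id: "R z = z" if "cmod z \<le> B + 1" for z
      unfolding R_def using that by (intro closest_point_self) simp
    have R_lip: "cmod (R y - R z) \<le> cmod (y - z)" for y z
      unfolding R_def using closest_point_lipschitz[OF D(2,1,3), of y z] by (simp add: dist_norm)
    have R_bd: "cmod (R z) \<le> B + 1" for z
      unfolding R_def using closest_point_in_set[OF D(1,3), of z] by simp
    have R: "\<forall>y z. cmod y \<le> B \<longrightarrow> cmod (R z - y) \<le> cmod (z - y)"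
    proof (intro allI impI)
      fix y z :: complex assume "cmod y \<le> B"
      then show "cmod (R z - y) \<le> cmod (z - y)" using R_lip[of z y] R_id[of y] by simp
    qed
    obtain P Q where g: "galerkin_coeffs N T \<kappa> w1 w2 m1 m2 R (fourier_coeff (Z 0)) (fourier_coeff (U 0)) P Q"
      using galerkin_coeffs_exists[of R "B + 1" T, OF R_bd R_lip] T by (meson less_imp_le)
    have small: "R (P t k) = P t k \<and> R (Q t k) = Q t k" if t: "t \<in> {0..T}" and k: "k \<in> {-int N..int N}" for t k
    proof -
      have "(cmod (P t k - fourier_coeff (Z t) k))\<^sup>2 + (cmod (Q t k - fourier_coeff (U t) k))\<^sup>2 \<le> err N P Q t"
        unfolding err_def by (rule member_le_sum[OF k]) auto
      also have "\<dots> \<le> 1" using bound[OF N R g t] by simp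
      finally have *: "(cmod (P t k - fourier_coeff (Z t) k))\<^sup>2 + (cmod (Q t k - fourier_coeff (U t) k))\<^sup>2 \<le> 1" .
      then have "(cmod (P t k - fourier_coeff (Z t) k))\<^sup>2 \<le> 1" "(cmod (Q t k - fourier_coeff (U t) k))\<^sup>2 \<le> 1"
        using zero_le_power2[of "cmod (P t k - fourier_coeff (Z t) k)"]
          zero_le_power2[of "cmod (Q t k - fourier_coeff (U t) k)"] by linarith+
      then have "cmod (P t k - fourier_coeff (Z t) k) \<le> 1" "cmod (Q t k - fourier_coeff (U t) k) \<le> 1"
        by (simp_all add: abs_square_le_1)
      moreover have "cmod (fourier_coeff (Z t) k) \<le> B" "cmod (fourier_coeff (U t) k) \<le> B"
        using norm_fourier_coeff_le[OF sqi(1)[OF t]] norm_fourier_coeff_le[OF sqi(2)[OF t]] normB[OF t]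
        by (meson order_trans)+
      ultimately show ?thesis
        using norm_triangle_sub[of "P t k" "fourier_coeff (Z t) k"] norm_triangle_sub[of "Q t k" "fourier_coeff (U t) k"]
        by (auto intro!: R_id)
    qed
    \<comment> \<open>The cut-off is known to act trivially only at frequencies up to
      \<open>N\<close>, and the convolution sees only those.\<close>
    have conv_cong: "trig_conv N a b = trig_conv N a' b'"
      if "\<And>k. k \<in> {-int N..int N} \<Longrightarrow> a k = a' k \<and> b k = b' k" for a b a' b'
    proof -
      have "trig_poly N a = trig_poly N a'" "trig_poly N b = trig_poly N b'"
        unfolding trig_poly_def fun_eq_iff using that by (auto intro!: sum.cong)
      then show ?thesis by (simp add: trig_conv_def)
    qed
    have "trig_conv N (\<lambda>j. R (P t j)) (\<lambda>j. R (Q t j)) = trig_conv N (\<lambda>j. id (P t j)) (\<lambda>j. id (Q t j))"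
      "trig_conv N (\<lambda>j. R (Q t j)) (\<lambda>j. R (Q t j)) = trig_conv N (\<lambda>j. id (Q t j)) (\<lambda>j. id (Q t j))"
      if "t \<in> {0..T}" for t
      using small[OF that] by (intro conv_cong; simp)+
    then have "galerkin_coeffs N T \<kappa> w1 w2 m1 m2 id (fourier_coeff (Z 0)) (fourier_coeff (U 0)) P Q"
      using g unfolding galerkin_coeffs_def by simp
    then show ?thesis by blast
  qed
  moreover have "L2_norm01 (\<lambda>x. trig_poly N (P t) x - Z t x) + L2_norm01 (\<lambda>x. trig_poly N (Q t) x - U t x)
      \<le> 2 * (C + B) * real N powr (- \<mu>)"
    if N: "N \<ge> N0" and t: "t \<in> {0..T}"
      and g: "galerkin_coeffs N T \<kappa> w1 w2 m1 m2 id (fourier_coeff (Z 0)) (fourier_coeff (U 0)) P Q" for N P Q t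
  proof -
    have "sqrt (err N P Q t) \<le> C * real N powr (- \<mu>)"
      using bound[OF N _ g t] by simp
    moreover have "N \<ge> 1" using N N0 by simp
    ultimately show ?thesis
      using trig_poly_error[OF t, of N "P t" P "Q t" Q] by (simp add: algebra_simps)
  qed
  ultimately show ?thesis using N0 by blast
qed

end

section \<open>Sobolev bounds\<close>

text \<open>A weak triangle inequality for squared norms, obtained term by term. The factors 2 are
  immaterial for boundedness, and Minkowski's inequality for infinite sums is avoided.\<close>

lemma Hs_diff_sum:
  assumes v: "v \<in> Hs s" and w: "w \<in> Hs s"
  shows "(\<Sum>\<^sub>\<infinity>k::int. (1 + (real_of_int k)\<^sup>2) powr s * (cmod (fourier_coeff v k))\<^sup>2)
    \<le> 2 * (Hs_norm s (\<lambda>x. v x - w x))\<^sup>2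
      + 2 * (\<Sum>\<^sub>\<infinity>k::int. (1 + (real_of_int k)\<^sup>2) powr s * (cmod (fourier_coeff w k))\<^sup>2)"
proof -
  let ?W = "\<lambda>k::int. (1 + (real_of_int k)\<^sup>2) powr s"
  let ?d = "fourier_coeff (\<lambda>x. v x - w x)"
  have sv: "(\<lambda>k. ?W k * (cmod (fourier_coeff v k))\<^sup>2) summable_on UNIV"
    and sw: "(\<lambda>k. ?W k * (cmod (fourier_coeff w k))\<^sup>2) summable_on UNIV"
    using v w by (auto simp: Hs_def)
  have d: "?d k = fourier_coeff v k - fourier_coeff w k" for k
    using v w by (intro fourier_coeff_diff) (auto simp: Hs_def)
  have par: "(cmod (x + y))\<^sup>2 \<le> 2 * (cmod x)\<^sup>2 + 2 * (cmod y)\<^sup>2" for x y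
  proof -
    have "(cmod (x + y))\<^sup>2 \<le> (cmod x + cmod y)\<^sup>2"
      by (intro power_mono norm_triangle_ineq) auto
    also have "\<dots> \<le> 2 * (cmod x)\<^sup>2 + 2 * (cmod y)\<^sup>2"
      using sum_squares_bound[of "cmod x" "cmod y"] by (simp add: power2_sum)
    finally show ?thesis .
  qed
  have sd: "(\<lambda>k. ?W k * (cmod (?d k))\<^sup>2) summable_on UNIV"
  proof (rule summable_on_comparison_test)
    show "(\<lambda>k. 2 * (?W k * (cmod (fourier_coeff v k))\<^sup>2) + 2 * (?W k * (cmod (fourier_coeff w k))\<^sup>2)) summable_on UNIV"
      by (intro summable_on_add summable_on_cmult_right sv sw)
    show "?W k * (cmod (?d k))\<^sup>2 \<le> 2 * (?W k * (cmod (fourier_coeff v k))\<^sup>2) + 2 * (?W k * (cmod (fourier_coeff w k))\<^sup>2)" for k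
      using mult_left_mono[OF par[of "fourier_coeff v k" "- fourier_coeff w k"], of "?W k"]
      by (simp add: d algebra_simps)
  qed auto
  have "(\<Sum>\<^sub>\<infinity>k. ?W k * (cmod (fourier_coeff v k))\<^sup>2)
      \<le> (\<Sum>\<^sub>\<infinity>k. 2 * (?W k * (cmod (?d k))\<^sup>2) + 2 * (?W k * (cmod (fourier_coeff w k))\<^sup>2))"
  proof (rule infsum_mono)
    show "(\<lambda>k. 2 * (?W k * (cmod (?d k))\<^sup>2) + 2 * (?W k * (cmod (fourier_coeff w k))\<^sup>2)) summable_on UNIV"
      by (intro summable_on_add summable_on_cmult_right sd sw)
    show "?W k * (cmod (fourier_coeff v k))\<^sup>2 \<le> 2 * (?W k * (cmod (?d k))\<^sup>2) + 2 * (?W k * (cmod (fourier_coeff w k))\<^sup>2)" for k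
      using mult_left_mono[OF par[of "?d k" "fourier_coeff w k"], of "?W k"]
      by (simp add: d algebra_simps)
  qed (rule sv)
  also have "\<dots> = 2 * (\<Sum>\<^sub>\<infinity>k. ?W k * (cmod (?d k))\<^sup>2) + 2 * (\<Sum>\<^sub>\<infinity>k. ?W k * (cmod (fourier_coeff w k))\<^sup>2)"
    using sd sw by (simp add: infsum_add summable_on_cmult_right infsum_cmult_right)
  also have "(\<Sum>\<^sub>\<infinity>k. ?W k * (cmod (?d k))\<^sup>2) = (Hs_norm s (\<lambda>x. v x - w x))\<^sup>2"
    unfolding Hs_norm_def by (simp add: infsum_nonneg)
  finally show ?thesis .
qed

text \<open>Near a time \<open>x\<close> the sum is at most \<open>2 + 2 * ?h x\<close>, by
  \<open>Hs_diff_sum\<close> at distance below 1. Bolzano's bisection principle combines these local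
  bounds over the compact interval.\<close>

lemma continuous_Hs_bounded:
  assumes v: "continuous_Hs T s v" and T: "T \<ge> 0"
  shows "\<exists>M\<ge>0. \<forall>t\<in>{0..T}. (\<Sum>\<^sub>\<infinity>k::int. (1 + (real_of_int k)\<^sup>2) powr s * (cmod (fourier_coeff (v t) k))\<^sup>2) \<le> M"
proof -
  let ?h = "\<lambda>t. \<Sum>\<^sub>\<infinity>k::int. (1 + (real_of_int k)\<^sup>2) powr s * (cmod (fourier_coeff (v t) k))\<^sup>2"
  have vHs: "v t \<in> Hs s" if "t \<in> {0..T}" for t
    using v that by (simp add: continuous_Hs_def)
  define P where "P a b \<longleftrightarrow> (\<exists>M. \<forall>t\<in>{0..T} \<inter> {a..b}. ?h t \<le> M)" for a b
  have "P 0 T"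
    using T
  proof (induction rule: Bolzano)
    case (trans a b c)
    then obtain M1 M2 where "\<forall>t\<in>{0..T} \<inter> {a..b}. ?h t \<le> M1" "\<forall>t\<in>{0..T} \<inter> {b..c}. ?h t \<le> M2"
      unfolding P_def by blast
    then have "\<forall>t\<in>{0..T} \<inter> {a..c}. ?h t \<le> max M1 M2"
      by (auto simp: le_max_iff_disj)
    then show ?case unfolding P_def by blast
  next
    case (local x)
    then have x: "x \<in> {0..T}" by simp
    have "((\<lambda>r. Hs_norm s (\<lambda>y. v r y - v x y)) \<longlongrightarrow> 0) (at x within {0..T})"
      using v x by (simp add: continuous_Hs_def)
    then have "\<forall>\<^sub>F r in at x within {0..T}. Hs_norm s (\<lambda>y. v r y - v x y) < 1"
      by (rule order_tendstoD) simp
    then obtain \<delta> where \<delta>: "\<delta> > 0"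
      and near: "\<And>r. r \<in> {0..T} \<Longrightarrow> r \<noteq> x \<Longrightarrow> dist r x < \<delta> \<Longrightarrow> Hs_norm s (\<lambda>y. v r y - v x y) < 1"
      unfolding eventually_at by blast
    have "?h r \<le> 2 + 2 * ?h x" if r: "r \<in> {0..T}" "dist r x < \<delta>" for r
    proof (cases "r = x")
      case True
      have "?h x \<ge> 0" by (intro infsum_nonneg) simp
      then show ?thesis unfolding True by linarith
    next
      case False
      have n0: "Hs_norm s (\<lambda>y. v r y - v x y) \<ge> 0"
        unfolding Hs_norm_def by (intro real_sqrt_ge_zero infsum_nonneg) simp
      have "(Hs_norm s (\<lambda>y. v r y - v x y))\<^sup>2 \<le> 1"
        using near[OF r(1) False r(2)] n0 by (simp add: abs_square_le_1)
      then show ?thesis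
        using Hs_diff_sum[OF vHs[OF r(1)] vHs[OF x]] by linarith
    qed
    then have "P a b" if "a \<le> x" "x \<le> b" "b - a < \<delta>" for a b
      unfolding P_def using that by (intro exI[of _ "2 + 2 * ?h x"]) (auto simp: dist_real_def)
    then show ?case using \<delta> by blast
  qed
  then obtain M where "\<forall>t\<in>{0..T}. ?h t \<le> M" unfolding P_def by auto
  then have "\<forall>t\<in>{0..T}. ?h t \<le> max 0 M" by (auto simp: le_max_iff_disj)
  then show ?thesis by (intro exI[of _ "max 0 M"]) auto
qed

text \<open>The Sobolev weight is at least 1 everywhere and at least
  \<open>(real N powr s)\<^sup>2\<close> at frequencies beyond \<open>N\<close>.\<close>

lemma Hs_L2_bounds:
  assumes v: "v \<in> Hs s" and s: "s \<ge> 0"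
    and M: "(\<Sum>\<^sub>\<infinity>k::int. (1 + (real_of_int k)\<^sup>2) powr s * (cmod (fourier_coeff v k))\<^sup>2) \<le> M"
  shows "L2_norm01 v \<le> 2 * sqrt M"
    and "N \<ge> 1 \<Longrightarrow> L2_norm01 (\<lambda>x. v x - trig_poly N (fourier_coeff v) x) \<le> sqrt M * real N powr (- s)"
proof -
  let ?W = "\<lambda>k::int. (1 + (real_of_int k)\<^sup>2) powr s"
  have sq: "square_integrable01 v"
    and sv: "(\<lambda>k. ?W k * (cmod (fourier_coeff v k))\<^sup>2) summable_on UNIV"
    using v by (auto simp: Hs_def)
  have fin: "(\<Sum>k\<in>F. ?W k * (cmod (fourier_coeff v k))\<^sup>2) \<le> M" if "finite F" for F
    using finite_sum_le_infsum[OF sv that] M by simp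
  have M0: "M \<ge> 0" using fin[of "{}"] by simp
  have fin1: "(\<Sum>k\<in>F. (cmod (fourier_coeff v k))\<^sup>2) \<le> M" if "finite F" for F
  proof -
    have "(cmod (fourier_coeff v k))\<^sup>2 \<le> ?W k * (cmod (fourier_coeff v k))\<^sup>2" for k
      using s ge_one_powr_ge_zero[of "1 + (real_of_int k)\<^sup>2" s] by (simp add: mult_le_cancel_right1)
    then have "(\<Sum>k\<in>F. (cmod (fourier_coeff v k))\<^sup>2) \<le> (\<Sum>k\<in>F. ?W k * (cmod (fourier_coeff v k))\<^sup>2)"
      by (intro sum_mono)
    then show ?thesis using fin[OF that] by simp
  qed
  \<comment> \<open>\<open>fourier_tail\<close> bounds only a remainder, so the mean value is split
    off as the truncation at 0 and estimated separately; hence the factor 2.\<close>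
  have "L2_norm01 (\<lambda>x. v x - trig_poly 0 (fourier_coeff v) x) \<le> sqrt M"
    using M0 fin1 by (intro fourier_tail sq) auto
  moreover have "(L2_norm01 (trig_poly 0 (fourier_coeff v)))\<^sup>2 \<le> M"
    unfolding L2_norm01_trig_poly by (rule fin1) simp
  then have "L2_norm01 (trig_poly 0 (fourier_coeff v)) \<le> sqrt M"
    by (rule real_le_rsqrt)
  moreover have "L2_norm01 (\<lambda>x. (v x - trig_poly 0 (fourier_coeff v) x) + trig_poly 0 (fourier_coeff v) x)
      \<le> L2_norm01 (\<lambda>x. v x - trig_poly 0 (fourier_coeff v) x) + L2_norm01 (trig_poly 0 (fourier_coeff v))"
    by (intro L2_norm01_triangle square_integrable01_diff sq square_integrable01_trig_poly)
  ultimately show "L2_norm01 v \<le> 2 * sqrt M" by simp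
  assume N: "N \<ge> 1"
  show "L2_norm01 (\<lambda>x. v x - trig_poly N (fourier_coeff v) x) \<le> sqrt M * real N powr (- s)"
  proof (rule fourier_tail[OF sq])
    fix L
    let ?F = "{-int L..int L} - {-int N..int N}"
    have "(\<Sum>k\<in>?F. (real N powr s)\<^sup>2 * (cmod (fourier_coeff v k))\<^sup>2) \<le> (\<Sum>k\<in>?F. ?W k * (cmod (fourier_coeff v k))\<^sup>2)"
    proof (intro sum_mono mult_right_mono)
      fix k assume "k \<in> ?F"
      then have "int N \<le> \<bar>k\<bar>" by auto
      then have "real N \<le> \<bar>real_of_int k\<bar>" by linarith
      then have "(real N)\<^sup>2 \<le> \<bar>real_of_int k\<bar>\<^sup>2" by (intro power_mono) auto
      then have "(real N)\<^sup>2 powr s \<le> ?W k"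
        using s by (intro powr_mono2) auto
      then show "(real N powr s)\<^sup>2 \<le> ?W k"
        by (simp add: powr_power powr_powr power2_eq_square powr_mult)
    qed auto
    also have "\<dots> \<le> M" by (rule fin) simp
    finally have "(real N powr s)\<^sup>2 * (\<Sum>k\<in>?F. (cmod (fourier_coeff v k))\<^sup>2) \<le> M"
      by (simp add: sum_distrib_left)
    then show "(\<Sum>k\<in>?F. (cmod (fourier_coeff v k))\<^sup>2) \<le> (sqrt M * real N powr (- s))\<^sup>2"
      using N M0 by (simp add: powr_minus power_mult_distrib field_simps)
  qed (use M0 in simp)
qed

section \<open>The B/FD system\<close>

definition freq :: "int \<Rightarrow> real" where "freq k = 2 * pi * real_of_int k"

text \<open>Each of the two weights is the symbol of its unknown in the other equation, with
  \<open>freq\<close> taken out. Used as energy weights, they give both cross terms the same product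
  of weights.\<close>

definition weight_u :: "real \<Rightarrow> real \<Rightarrow> real \<Rightarrow> int \<Rightarrow> real" where
  "weight_u \<gamma> a b k = bfd_g \<gamma> a (freq k) / (1 + b * (freq k)\<^sup>2)"

definition weight_zeta :: "real \<Rightarrow> real \<Rightarrow> real \<Rightarrow> int \<Rightarrow> real" where
  "weight_zeta \<gamma> c d k = (1 - \<gamma>) * (1 - c * (freq k)\<^sup>2) / (1 + d * (freq k)\<^sup>2)"

definition smoothing :: "real \<Rightarrow> real \<Rightarrow> int \<Rightarrow> real" where
  "smoothing e b k = e * (freq k / (1 + b * (freq k)\<^sup>2))"

text \<open>The equations determine the time derivatives, so solving for them removes the
  existential quantifiers.\<close>

lemma bfd_fourier_system_iff:
  "bfd_fourier_system K T \<gamma> a b c d \<zeta> u \<longleftrightarrow> (\<forall>k\<in>K. \<forall>t\<in>{0..T}.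
     ((\<lambda>r. fourier_coeff (\<zeta> r) k) has_vector_derivative
        - \<i> * of_real (freq k * weight_u \<gamma> a b k) * fourier_coeff (u t) k
        + \<i> * of_real (smoothing (1 / \<gamma>) b k) * fourier_coeff (\<lambda>x. \<zeta> t x * u t x) k) (at t within {0..T}) \<and>
     ((\<lambda>r. fourier_coeff (u r) k) has_vector_derivative
        - \<i> * of_real (freq k * weight_zeta \<gamma> c d k) * fourier_coeff (\<zeta> t) k
        + \<i> * of_real (smoothing (1 / (2 * \<gamma>)) d k) * fourier_coeff (\<lambda>x. u t x * u t x) k) (at t within {0..T}))"
proof -
  have eq: "z' + \<i> * p * q = r \<longleftrightarrow> z' = - \<i> * p * q + r" for z' p q r :: complex
    by (auto simp: algebra_simps)
  have comm: "x / y * z = x * (z / y)" for x y z :: real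
    by simp
  show ?thesis
    unfolding bfd_fourier_system_def Let_def freq_def[symmetric] eq comm[of _ _ "bfd_g _ _ _"]
      weight_u_def weight_zeta_def smoothing_def power2_eq_square[of "_ :: complex"]
    by blast
qed

text \<open>The term at \<open>k = 0\<close> is 0 by the convention for division, and the two halves
  are equal.\<close>

lemma sum_inverse_squares_le: "(\<Sum>k=-int N..int N. 1 / (real_of_int k)\<^sup>2) \<le> 4"
proof -
  have step: "(\<Sum>k=-int (Suc N)..int (Suc N). f k) = f (- int (Suc N)) + f (int (Suc N)) + (\<Sum>k=-int N..int N. f k)"
    for N and f :: "int \<Rightarrow> real"
  proof -
    have "{-int (Suc N)..int (Suc N)} = insert (- int (Suc N)) (insert (int (Suc N)) {-int N..int N})" by auto
    then show ?thesis by (simp del: of_nat_Suc)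
  qed
  \<comment> \<open>Strengthened so that the induction closes: \<open>1 / (x + 1)\<^sup>2\<close> is
    at most the telescoping difference \<open>1 / x - 1 / (x + 1)\<close>, counted twice.\<close>
  have "(\<Sum>k=-int (Suc N)..int (Suc N). 1 / (real_of_int k)\<^sup>2) \<le> 4 - 2 / real (Suc N)" for N
  proof (induction N)
    case 0
    show ?case unfolding step by simp
  next
    case (Suc N)
    define x where "x = real (Suc N)"
    have x: "x \<ge> 1" by (simp add: x_def)
    have "1 / (x + 1)\<^sup>2 \<le> 1 / (x * (x + 1))"
      using x by (intro divide_left_mono) (auto simp: power2_eq_square)
    also have "\<dots> = 1 / x - 1 / (x + 1)"
      using x by (simp add: field_simps)
    finally have "2 / (x + 1)\<^sup>2 \<le> 2 / x - 2 / (x + 1)" by simp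
    then show ?case using Suc.IH unfolding step[where N = "Suc N"] by (simp add: x_def add_ac del: of_nat_Suc) (simp add: add_ac)
  qed
  from this[of "N - 1"] show ?thesis
  proof (cases N)
    case (Suc M)
    have "(\<Sum>k=-int N..int N. 1 / (real_of_int k)\<^sup>2) \<le> 4 - 2 / real N"
      using \<open>(\<Sum>k=-int (Suc (N - 1))..int (Suc (N - 1)). 1 / (real_of_int k)\<^sup>2) \<le> 4 - 2 / real (Suc (N - 1))\<close> Suc
      by simp
    then show ?thesis by (rule order_trans) simp
  qed simp
qed

text \<open>Dropping the 1 in the denominator leaves a multiple of the inverse frequency, whose
  squares are summable. At \<open>k = 0\<close> both sides of the termwise bound vanish.\<close>

lemma sum_smoothing_le:
  assumes b: "b > 0"
  shows "(\<Sum>k=-int N..int N. (smoothing e b k)\<^sup>2) \<le> 4 * (e / b)\<^sup>2"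
proof -
  have "(smoothing e b k)\<^sup>2 \<le> (e / b)\<^sup>2 * (1 / (real_of_int k)\<^sup>2)" for k
  proof (cases "k = 0")
    case False
    have k: "\<bar>real_of_int k\<bar> \<le> \<bar>freq k\<bar>"
      using pi_gt3 by (simp add: freq_def abs_mult mult_le_cancel_right1)
    have k0: "\<bar>freq k\<bar> > 0" using False by (simp add: freq_def)
    have "\<bar>freq k / (1 + b * (freq k)\<^sup>2)\<bar> = \<bar>freq k\<bar> / (1 + b * (freq k)\<^sup>2)"
      using b by (simp add: abs_divide abs_of_nonneg)
    also have "\<dots> \<le> \<bar>freq k\<bar> / (b * (freq k)\<^sup>2)"
      using b k0 by (intro divide_left_mono mult_pos_pos) (auto intro: add_pos_nonneg)
    also have "\<dots> = 1 / (b * \<bar>freq k\<bar>)"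
      using k0 unfolding power2_abs[of "freq k", symmetric] by (simp add: power2_eq_square del: power2_abs abs_mult_self_eq)
    also have "\<dots> \<le> 1 / (b * \<bar>real_of_int k\<bar>)"
      using b k False by (intro divide_left_mono mult_left_mono mult_pos_pos) auto
    finally have "\<bar>smoothing e b k\<bar> \<le> \<bar>e\<bar> * (1 / (b * \<bar>real_of_int k\<bar>))"
      unfolding smoothing_def abs_mult by (intro mult_left_mono) auto
    then have "\<bar>smoothing e b k\<bar>\<^sup>2 \<le> (\<bar>e\<bar> * (1 / (b * \<bar>real_of_int k\<bar>)))\<^sup>2"
      by (intro power_mono) auto
    then show ?thesis by (simp add: power_mult_distrib power_divide)
  qed (simp add: smoothing_def freq_def)
  then have "(\<Sum>k=-int N..int N. (smoothing e b k)\<^sup>2) \<le> (\<Sum>k=-int N..int N. (e / b)\<^sup>2 * (1 / (real_of_int k)\<^sup>2))"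
    by (intro sum_mono)
  also have "\<dots> = (e / b)\<^sup>2 * (\<Sum>k=-int N..int N. 1 / (real_of_int k)\<^sup>2)"
    by (rule sum_distrib_left[symmetric])
  also have "\<dots> \<le> (e / b)\<^sup>2 * 4"
    by (intro mult_left_mono sum_inverse_squares_le) auto
  finally show ?thesis by simp
qed

section \<open>Two-sided bounds for the symbols\<close>

lemma coth_bounds:
  assumes x: "x > 0"
  shows "x * coth x \<ge> 0" "x * coth x \<le> 1 + x"
proof -
  have s: "sinh x > 0" using x by simp
  show "x * coth x \<ge> 0" using x s by (simp add: coth_def)
  have sx: "x \<le> sinh x"
  proof -
    have "sinh 0 - 0 \<le> sinh x - x"
      by (rule DERIV_nonneg_imp_nondecreasing[of 0 x "\<lambda>x. sinh x - x"])
        (use x cosh_real_ge_1 in \<open>auto intro!: derivative_eq_intros exI\<close>)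
    then show ?thesis by simp
  qed
  \<comment> \<open>The excess of \<open>cosh\<close> over \<open>sinh\<close> decays:
    \<open>x * exp (- x)\<close> is at most \<open>x\<close>, hence at most
    \<open>sinh x\<close>.\<close>
  have "cosh x = sinh x + exp (- x)"
    by (simp add: sinh_def cosh_def field_simps)
  then have "x * cosh x = x * sinh x + x * exp (- x)"
    by (simp add: distrib_left)
  also have "x * exp (- x) \<le> sinh x * 1"
    using x sx by (intro mult_mono) auto
  finally have "x * cosh x \<le> (1 + x) * sinh x" by (simp add: algebra_simps)
  then show "x * coth x \<le> 1 + x"
    using s by (simp add: coth_def divide_le_eq)
qed

text \<open>With \<open>y = |\<kappa>| coth |\<kappa>| / \<gamma>\<close>, the part of \<open>g\<close> free of \<open>a\<close> is \<open>(1 - y + y\<^sup>2) / \<gamma>\<close>, and \<open>1 - y + y\<^sup>2 \<ge> 3 / 4\<close>.\<close>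

lemma bfd_g_bounds:
  assumes \<gamma>: "\<gamma> > 0" and a: "a < 0"
  shows "bfd_g \<gamma> a x \<ge> 3 / (4 * \<gamma>) + (- a / \<gamma>) * x\<^sup>2"
    and "bfd_g \<gamma> a x \<le> (1 / \<gamma> + 2 / \<gamma>^3) + (- a / \<gamma> + 2 / \<gamma>^3) * x\<^sup>2"
proof -
  \<comment> \<open>\<open>z\<close> is \<open>\<bar>x\<bar> * coth \<bar>x\<bar>\<close>, with its
    limit 1 at \<open>x = 0\<close>; this removes the case distinction in
    \<open>bfd_g\<close>.\<close>
  obtain z where z: "0 \<le> z" "z \<le> 1 + \<bar>x\<bar>" and g: "bfd_g \<gamma> a x = 1 / \<gamma> - z / \<gamma>\<^sup>2 + z\<^sup>2 / \<gamma>^3 + (- a / \<gamma>) * x\<^sup>2"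
  proof (cases "x = 0")
    case True
    then show ?thesis by (intro that[of 1]) (auto simp: bfd_g_def)
  next
    case False
    then show ?thesis
      using coth_bounds[of "\<bar>x\<bar>"]
      by (intro that[of "\<bar>x\<bar> * coth \<bar>x\<bar>"]) (auto simp: bfd_g_def power_mult_distrib)
  qed
  have "1 / \<gamma> - z / \<gamma>\<^sup>2 + z\<^sup>2 / \<gamma>^3 = 3 / (4 * \<gamma>) + (z / \<gamma> - 1 / 2)\<^sup>2 / \<gamma>"
    using \<gamma> by (simp add: field_simps power2_eq_square power3_eq_cube)
  then show "bfd_g \<gamma> a x \<ge> 3 / (4 * \<gamma>) + (- a / \<gamma>) * x\<^sup>2"
    using \<gamma> unfolding g by simp
  have "z\<^sup>2 \<le> (1 + \<bar>x\<bar>)\<^sup>2" using z by (intro power_mono) auto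
  also have "\<dots> \<le> 2 + 2 * x\<^sup>2"
    using sum_squares_bound[of 1 "\<bar>x\<bar>"] by (simp add: power2_sum)
  finally have "z\<^sup>2 / \<gamma>^3 \<le> (2 + 2 * x\<^sup>2) / \<gamma>^3"
    using \<gamma> by (intro divide_right_mono) auto
  moreover have "z / \<gamma>\<^sup>2 \<ge> 0" using z by simp
  ultimately show "bfd_g \<gamma> a x \<le> (1 / \<gamma> + 2 / \<gamma>^3) + (- a / \<gamma> + 2 / \<gamma>^3) * x\<^sup>2"
    unfolding g by (simp add: add_divide_distrib algebra_simps)
qed

text \<open>The quotient of \<open>p + q * s\<close> by \<open>1 + d * s\<close> is a weighted mean
  of \<open>p\<close> and \<open>q / d\<close>, with weights 1 and \<open>d * s\<close>.\<close>

lemma quotient_bounds: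
  fixes p q s d :: real
  assumes "s \<ge> 0" "d > 0"
  shows "n \<ge> p + q * s \<Longrightarrow> n / (1 + d * s) \<ge> min p (q / d)"
    and "n \<le> p + q * s \<Longrightarrow> n / (1 + d * s) \<le> max p (q / d)"
proof -
  have pos: "1 + d * s > 0" using assms by (simp add: add_pos_nonneg)
  have "min p (q / d) * (1 + d * s) \<le> p + q / d * (d * s)"
    unfolding distrib_left using assms by (intro add_mono mult_right_mono) auto
  then show "n \<ge> p + q * s \<Longrightarrow> n / (1 + d * s) \<ge> min p (q / d)"
    using assms pos by (simp add: le_divide_eq)
  have "p + q / d * (d * s) \<le> max p (q / d) * (1 + d * s)"
    unfolding distrib_left using assms by (intro add_mono mult_right_mono) auto
  then show "n \<le> p + q * s \<Longrightarrow> n / (1 + d * s) \<le> max p (q / d)"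
    using assms pos by (simp add: divide_le_eq)
qed

text \<open>The signs of \<open>a\<close>, \<open>c\<close> and \<open>1 - \<gamma>\<close> enter
  here: they make both numerators positive and of second order in the frequency, like the
  denominators.\<close>

lemma weight_bounds:
  assumes "0 < \<gamma>" "\<gamma> < 1" "b > 0" "d > 0" "a < 0" "c < 0"
  shows "\<exists>wl wh. wl > 0 \<and> (\<forall>k. wl \<le> weight_zeta \<gamma> c d k \<and> weight_zeta \<gamma> c d k \<le> wh \<and>
    wl \<le> weight_u \<gamma> a b k \<and> weight_u \<gamma> a b k \<le> wh)"
proof -
  define l1 where "l1 = min (1 - \<gamma>) ((1 - \<gamma>) * (- c) / d)"
  define h1 where "h1 = max (1 - \<gamma>) ((1 - \<gamma>) * (- c) / d)"
  define l2 where "l2 = min (3 / (4 * \<gamma>)) ((- a / \<gamma>) / b)"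
  define h2 where "h2 = max (1 / \<gamma> + 2 / \<gamma>^3) ((- a / \<gamma> + 2 / \<gamma>^3) / b)"
  have "l1 > 0" "l2 > 0"
    using assms by (auto simp: l1_def l2_def divide_neg_pos mult_pos_neg)
  moreover have "l1 \<le> weight_zeta \<gamma> c d k" "weight_zeta \<gamma> c d k \<le> h1" for k
  proof -
    have n: "(1 - \<gamma>) * (1 - c * (freq k)\<^sup>2) = (1 - \<gamma>) + (1 - \<gamma>) * (- c) * (freq k)\<^sup>2"
      by (simp add: algebra_simps)
    show "l1 \<le> weight_zeta \<gamma> c d k"
      unfolding weight_zeta_def l1_def n by (rule quotient_bounds(1)) (use assms in auto)
    show "weight_zeta \<gamma> c d k \<le> h1"
      unfolding weight_zeta_def h1_def n by (rule quotient_bounds(2)) (use assms in auto)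
  qed
  moreover have "l2 \<le> weight_u \<gamma> a b k" "weight_u \<gamma> a b k \<le> h2" for k
    unfolding weight_u_def l2_def h2_def
    by (rule quotient_bounds(1)[OF _ _ bfd_g_bounds(1)] quotient_bounds(2)[OF _ _ bfd_g_bounds(2)]; use assms in simp)+
  ultimately show ?thesis
    by (intro exI[of _ "min l1 l2"] exI[of _ "max h1 h2"]) (auto simp: min_le_iff_disj le_max_iff_disj)
qed

section \<open>Galerkin solutions as functions and as coefficient families\<close>

lemma bfd_galerkin_coeffs:
  assumes "bfd_galerkin N T \<gamma> a b c d \<zeta>0 u0 \<zeta>N uN" and T: "T \<ge> 0"
  shows "galerkin_coeffs N T freq (weight_zeta \<gamma> c d) (weight_u \<gamma> a b) (smoothing (1 / \<gamma>) b) (smoothing (1 / (2 * \<gamma>)) d)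
      id (fourier_coeff (\<lambda>x. of_real (\<zeta>0 x))) (fourier_coeff (\<lambda>x. of_real (u0 x)))
      (\<lambda>t. fourier_coeff (\<zeta>N t)) (\<lambda>t. fourier_coeff (uN t))"
    and "t \<in> {0..T} \<Longrightarrow> \<zeta>N t = trig_poly N (fourier_coeff (\<zeta>N t))"
    and "t \<in> {0..T} \<Longrightarrow> uN t = trig_poly N (fourier_coeff (uN t))"
proof -
  have self: "f = trig_poly N (fourier_coeff f)" if f: "f \<in> trig_space N" for f
  proof -
    obtain p where p: "f = trig_poly N p" using f by (auto simp: trig_space_eq_range)
    define q where "q = fourier_coeff (trig_poly N p)"
    have "q k = p k" if "k \<in> {-int N..int N}" for k
      using that by (simp add: q_def fourier_coeff_trig_poly)
    then have "trig_poly N p = trig_poly N q"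
      by (auto simp: fun_eq_iff trig_poly_def intro!: sum.cong)
    then show ?thesis unfolding p q_def .
  qed
  show z: "\<zeta>N t = trig_poly N (fourier_coeff (\<zeta>N t))" and u: "uN t = trig_poly N (fourier_coeff (uN t))"
    if "t \<in> {0..T}" for t
    using assms(1) that by (auto simp: bfd_galerkin_def intro!: self)
  show "galerkin_coeffs N T freq (weight_zeta \<gamma> c d) (weight_u \<gamma> a b) (smoothing (1 / \<gamma>) b) (smoothing (1 / (2 * \<gamma>)) d)
      id (fourier_coeff (\<lambda>x. of_real (\<zeta>0 x))) (fourier_coeff (\<lambda>x. of_real (u0 x)))
      (\<lambda>t. fourier_coeff (\<zeta>N t)) (\<lambda>t. fourier_coeff (uN t))"
    using assms(1) z u T unfolding bfd_galerkin_def galerkin_coeffs_def bfd_fourier_system_iff trig_conv_def by simp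
qed

lemma galerkin_coeffs_bfd:
  assumes "galerkin_coeffs N T freq (weight_zeta \<gamma> c d) (weight_u \<gamma> a b) (smoothing (1 / \<gamma>) b) (smoothing (1 / (2 * \<gamma>)) d)
      id (fourier_coeff (\<lambda>x. of_real (\<zeta>0 x))) (fourier_coeff (\<lambda>x. of_real (u0 x))) P Q"
  shows "bfd_galerkin N T \<gamma> a b c d \<zeta>0 u0 (\<lambda>t. trig_poly N (P t)) (\<lambda>t. trig_poly N (Q t))"
  using assms unfolding bfd_galerkin_def galerkin_coeffs_def bfd_fourier_system_iff trig_conv_def
  by (auto simp: fourier_coeff_trig_poly trig_space_eq_range)

theorem proposition2p2:
  fixes \<alpha>1 \<alpha>2 \<beta> a b c d \<gamma> T \<mu> :: real
    and \<zeta>0 u0 :: "real \<Rightarrow> real"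
    and \<zeta> u :: "real \<Rightarrow> real \<Rightarrow> real"
  assumes "\<alpha>1 \<ge> 0" and "\<alpha>2 \<le> 1" and "\<beta> \<ge> 0"
    and "a = (1 - \<alpha>1 - 3 * \<beta>) / 3" and "b = \<alpha>1 / 3"
    and "c = \<beta> * \<alpha>2" and "d = \<beta> * (1 - \<alpha>2)"
    and "0 < \<gamma>" and "\<gamma> < 1" and "T > 0"
    and "b > 0" and "d > 0" and "a < 0" and "c < 0"
    and "\<mu> \<ge> 1"
    and "(\<lambda>x. complex_of_real (\<zeta>0 x)) \<in> Hs \<mu>" and "(\<lambda>x. complex_of_real (u0 x)) \<in> Hs \<mu>"
    and "bfd_unique_solution \<mu> T \<gamma> a b c d \<zeta>0 u0 \<zeta> u"
  shows "\<exists>N0::nat. N0 \<ge> 1 \<and> (\<exists>C::real. \<forall>N\<ge>N0.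
    (\<exists>\<zeta>N uN. bfd_galerkin N T \<gamma> a b c d \<zeta>0 u0 \<zeta>N uN) \<and>
    (\<forall>\<zeta>N uN. bfd_galerkin N T \<gamma> a b c d \<zeta>0 u0 \<zeta>N uN \<longrightarrow>
      (\<forall>t\<in>{0..T}. L2_norm01 (\<lambda>x. \<zeta>N t x - complex_of_real (\<zeta> t x))
                  + L2_norm01 (\<lambda>x. uN t x - complex_of_real (u t x)) \<le> C * real N powr (- \<mu>))))"
proof -
  define Z where "Z t x = complex_of_real (\<zeta> t x)" for t x
  define U where "U t x = complex_of_real (u t x)" for t x
  have T0: "T \<ge> 0" using \<open>T > 0\<close> by simp
  have sol: "bfd_solution \<mu> T \<gamma> a b c d \<zeta>0 u0 \<zeta> u"
    using assms by (simp add: bfd_unique_solution_def)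
  \<comment> \<open>The initial data are traded for the exact solution at time 0; they share all
    coefficients, so the energy of the error starts at 0.\<close>
  have cZ: "continuous_Hs T \<mu> Z" and cU: "continuous_Hs T \<mu> U"
    and sys: "bfd_fourier_system UNIV T \<gamma> a b c d Z U"
    and Z0: "fourier_coeff (\<lambda>x. complex_of_real (\<zeta>0 x)) = fourier_coeff (Z 0)"
    and U0: "fourier_coeff (\<lambda>x. complex_of_real (u0 x)) = fourier_coeff (U 0)"
    using sol by (simp_all add: bfd_solution_def Z_def[abs_def] U_def[abs_def] fun_eq_iff)
  have HZ: "Z t \<in> Hs \<mu>" and HU: "U t \<in> Hs \<mu>" if "t \<in> {0..T}" for t
    using cZ cU that by (simp_all add: continuous_Hs_def)
  obtain M1 where M1: "M1 \<ge> 0" "\<And>t. t \<in> {0..T} \<Longrightarrow>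
      (\<Sum>\<^sub>\<infinity>k::int. (1 + (real_of_int k)\<^sup>2) powr \<mu> * (cmod (fourier_coeff (Z t) k))\<^sup>2) \<le> M1"
    using continuous_Hs_bounded[OF cZ T0] by blast
  obtain M2 where M2: "M2 \<ge> 0" "\<And>t. t \<in> {0..T} \<Longrightarrow>
      (\<Sum>\<^sub>\<infinity>k::int. (1 + (real_of_int k)\<^sup>2) powr \<mu> * (cmod (fourier_coeff (U t) k))\<^sup>2) \<le> M2"
    using continuous_Hs_bounded[OF cU T0] by blast
  \<comment> \<open>The factor 2 is that of the norm bound in \<open>Hs_L2_bounds\<close>; the
    truncation rate holds with the smaller constant \<open>sqrt (max M1 M2)\<close>.\<close>
  define B where "B = 2 * sqrt (max M1 M2)"
  obtain wl wh where w: "wl > 0" "\<And>k. wl \<le> weight_zeta \<gamma> c d k" "\<And>k. weight_zeta \<gamma> c d k \<le> wh"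
    "\<And>k. wl \<le> weight_u \<gamma> a b k" "\<And>k. weight_u \<gamma> a b k \<le> wh"
    using weight_bounds[of \<gamma> b d a c] assms by blast
  \<comment> \<open>The values of \<open>sum_smoothing_le\<close> for the multipliers of the two
    equations.\<close>
  define S where "S = max (4 * (1 / \<gamma> / b)\<^sup>2) (4 * (1 / (2 * \<gamma>) / d)\<^sup>2)"
  have bounds: "L2_norm01 v \<le> B" "N \<ge> 1 \<Longrightarrow> L2_norm01 (\<lambda>x. v x - trig_poly N (fourier_coeff v) x) \<le> B * real N powr (- \<mu>)"
    if "v \<in> Hs \<mu>" and le: "(\<Sum>\<^sub>\<infinity>k::int. (1 + (real_of_int k)\<^sup>2) powr \<mu> * (cmod (fourier_coeff v k))\<^sup>2) \<le> max M1 M2" for v N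
  proof -
    have \<mu>: "\<mu> \<ge> 0" using \<open>\<mu> \<ge> 1\<close> by simp
    show "L2_norm01 v \<le> B" unfolding B_def by (rule Hs_L2_bounds(1)[OF that(1) \<mu> le])
    assume "N \<ge> 1"
    then have "L2_norm01 (\<lambda>x. v x - trig_poly N (fourier_coeff v) x) \<le> sqrt (max M1 M2) * real N powr (- \<mu>)"
      by (rule Hs_L2_bounds(2)[OF that(1) \<mu> le])
    also have "\<dots> \<le> B * real N powr (- \<mu>)"
      using M1(1) unfolding B_def by (intro mult_right_mono) auto
    finally show "L2_norm01 (\<lambda>x. v x - trig_poly N (fourier_coeff v) x) \<le> B * real N powr (- \<mu>)" .
  qed
  interpret bfd_exact T \<mu> wl wh S B freq "weight_zeta \<gamma> c d" "weight_u \<gamma> a b"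
    "smoothing (1 / \<gamma>) b" "smoothing (1 / (2 * \<gamma>)) d" Z U
  proof
    show "(\<Sum>k=-int N..int N. (smoothing (1 / \<gamma>) b k)\<^sup>2) \<le> S" for N
      unfolding S_def by (rule max.coboundedI1[OF sum_smoothing_le[OF \<open>b > 0\<close>]])
    show "(\<Sum>k=-int N..int N. (smoothing (1 / (2 * \<gamma>)) d k)\<^sup>2) \<le> S" for N
      unfolding S_def by (rule max.coboundedI2[OF sum_smoothing_le[OF \<open>d > 0\<close>]])
    fix t assume t: "t \<in> {0..T}"
    show "square_integrable01 (Z t)" "square_integrable01 (U t)"
      using HZ[OF t] HU[OF t] by (simp_all add: Hs_def)
    have mZ: "(\<Sum>\<^sub>\<infinity>k::int. (1 + (real_of_int k)\<^sup>2) powr \<mu> * (cmod (fourier_coeff (Z t) k))\<^sup>2) \<le> max M1 M2"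
      and mU: "(\<Sum>\<^sub>\<infinity>k::int. (1 + (real_of_int k)\<^sup>2) powr \<mu> * (cmod (fourier_coeff (U t) k))\<^sup>2) \<le> max M1 M2"
      using M1(2)[OF t] M2(2)[OF t] by (simp_all add: le_max_iff_disj)
    show "L2_norm01 (Z t) \<le> B" "L2_norm01 (U t) \<le> B"
      using bounds(1)[OF HZ[OF t] mZ] bounds(1)[OF HU[OF t] mU] by auto
    show "L2_norm01 (\<lambda>x. Z t x - trig_poly N (fourier_coeff (Z t)) x) \<le> B * real N powr - \<mu>" if "1 \<le> N" for N
      using bounds(2)[OF HZ[OF t] mZ that] .
    show "L2_norm01 (\<lambda>x. U t x - trig_poly N (fourier_coeff (U t)) x) \<le> B * real N powr - \<mu>" if "1 \<le> N" for N
      using bounds(2)[OF HU[OF t] mU that] .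
  qed (use assms w sys in \<open>auto simp: bfd_fourier_system_iff\<close>)
  obtain N0 C where N0: "N0 \<ge> 1"
    and ex: "\<And>N. N \<ge> N0 \<Longrightarrow> \<exists>P Q. galerkin_coeffs N T freq (weight_zeta \<gamma> c d) (weight_u \<gamma> a b)
      (smoothing (1 / \<gamma>) b) (smoothing (1 / (2 * \<gamma>)) d) id (fourier_coeff (Z 0)) (fourier_coeff (U 0)) P Q"
    and err: "\<And>N P Q t. N \<ge> N0 \<Longrightarrow> galerkin_coeffs N T freq (weight_zeta \<gamma> c d) (weight_u \<gamma> a b)
      (smoothing (1 / \<gamma>) b) (smoothing (1 / (2 * \<gamma>)) d) id (fourier_coeff (Z 0)) (fourier_coeff (U 0)) P Q \<Longrightarrow>
      t \<in> {0..T} \<Longrightarrow> L2_norm01 (\<lambda>x. trig_poly N (P t) x - Z t x) + L2_norm01 (\<lambda>x. trig_poly N (Q t) x - U t x)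
        \<le> C * real N powr (- \<mu>)"
    using galerkin_convergence by blast
  have "\<exists>\<zeta>N uN. bfd_galerkin N T \<gamma> a b c d \<zeta>0 u0 \<zeta>N uN" if "N \<ge> N0" for N
    using ex[OF that] galerkin_coeffs_bfd[of N T \<gamma> c d a b \<zeta>0 u0] unfolding Z0 U0 by blast
  moreover have "L2_norm01 (\<lambda>x. \<zeta>N t x - complex_of_real (\<zeta> t x)) + L2_norm01 (\<lambda>x. uN t x - complex_of_real (u t x))
      \<le> C * real N powr (- \<mu>)"
    if N: "N \<ge> N0" and g: "bfd_galerkin N T \<gamma> a b c d \<zeta>0 u0 \<zeta>N uN" and t: "t \<in> {0..T}" for N \<zeta>N uN t
    using err[OF N bfd_galerkin_coeffs(1)[OF g T0, unfolded Z0 U0] t]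
      bfd_galerkin_coeffs(2,3)[OF g T0 t] by (simp add: Z_def U_def)
  ultimately show ?thesis using N0 by blast
qed

end
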